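(* There exist absolute constants $c>0$ and $n_0\in\mathbb{N}$ such that for every $n\geq n_0$ and every log-concave probability measure $\mu$ on $\mathbb{R}^n$, $$\mathbb{E}_{\mu}(\varphi_{\mu}):=\int_{\mathbb{R}^n}\varphi_{\mu}(x)\,d\mu(x)\leq \exp\left(-cn/L_{\mu}^2\right),$$ where $L_\mu$ is the isotropic constant of $\mu$.
   Context: A log-concave probability measure on $\mathbb{R}^n$ is a Borel probability measure $\mu$ such that $\mu(\lambda A+(1-\lambda)B)\geq \mu(A)^{\lambda}\mu(B)^{1-\lambda}$ for all compact $A,B\subseteq\mathbb{R}^n$ and $\lambda\in(0,1)$, and $\mu(H)<1$ for every hyperplane $H$; such a measure has a log-concave density $f_\mu$. Tukey's half-space depth is $\varphi_\mu(x)=\inf\{\mu(H): H\in\mathcal{H}(x)\}$, where $\mathcal{H}(x)$ is the set of all half-spaces of $\mathbb{R}^n$ containing $x$. The isotropic constant is $L_\mu=\left(\sup_{x} f_\mu(x)\right)^{1/n}[\det \mathrm{Cov}(\mu)]^{1/(2n)}$, where $\mathrm{Cov}(\mu)$ is the covariance matrix of $\mu$. *)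

theory Defs
  imports "HOL-Probability.Probability" "Jordan_Normal_Form.Determinant"
begin

text \<open>Euclidean space R^n is modelled as the finite product measure space of n copies of
  the real line: points are functions nat => real, extensional on {..<n}.
  This is Lebesgue (Borel) measure on R^n.\<close>

definition Rn :: "nat \<Rightarrow> (nat \<Rightarrow> real) measure" where
  "Rn n = (\<Pi>\<^sub>M i\<in>{..<n}. (lborel :: real measure))"

definition cmb :: "nat \<Rightarrow> real \<Rightarrow> (nat \<Rightarrow> real) \<Rightarrow> (nat \<Rightarrow> real) \<Rightarrow> (nat \<Rightarrow> real)" where
  "cmb n l a b = restrict (\<lambda>i. l * a i + (1 - l) * b i) {..<n}"

definition mink :: "nat \<Rightarrow> real \<Rightarrow> (nat \<Rightarrow> real) set \<Rightarrow> (nat \<Rightarrow> real) set \<Rightarrow> (nat \<Rightarrow> real) set" where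
  "mink n l A B = {cmb n l a b | a b. a \<in> A \<and> b \<in> B}"

definition ip :: "nat \<Rightarrow> (nat \<Rightarrow> real) \<Rightarrow> (nat \<Rightarrow> real) \<Rightarrow> real" where
  "ip n a x = (\<Sum>i<n. a i * x i)"

definition hyperplanes :: "nat \<Rightarrow> (nat \<Rightarrow> real) set set" where
  "hyperplanes n = {{x \<in> space (Rn n). ip n a x = b} | a b. \<exists>i<n. a i \<noteq> 0}"

definition halfspaces :: "nat \<Rightarrow> (nat \<Rightarrow> real) set set" where
  "halfspaces n = {{x \<in> space (Rn n). ip n a x \<le> b} | a b. \<exists>i<n. a i \<noteq> 0}"

definition logconcave_measure :: "nat \<Rightarrow> (nat \<Rightarrow> real) measure \<Rightarrow> bool" where
  "logconcave_measure n \<mu> \<longleftrightarrow>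
     sets \<mu> = sets (Rn n) \<and> prob_space \<mu> \<and>
     (\<forall>A B l. A \<subseteq> space (Rn n) \<and> B \<subseteq> space (Rn n) \<and> compact A \<and> compact B
        \<and> 0 < l \<and> l < 1 \<longrightarrow>
        measure \<mu> (mink n l A B) \<ge> measure \<mu> A powr l * measure \<mu> B powr (1 - l)) \<and>
     (\<forall>H \<in> hyperplanes n. measure \<mu> H < 1)"

definition logconcave_density :: "nat \<Rightarrow> (nat \<Rightarrow> real) measure \<Rightarrow> ((nat \<Rightarrow> real) \<Rightarrow> real) \<Rightarrow> bool" where
  "logconcave_density n \<mu> f \<longleftrightarrow>
     f \<in> borel_measurable (Rn n) \<and> (\<forall>x \<in> space (Rn n). 0 \<le> f x) \<and>
     \<mu> = density (Rn n) (\<lambda>x. ennreal (f x)) \<and>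
     (\<forall>x \<in> space (Rn n). \<forall>y \<in> space (Rn n). \<forall>l. 0 < l \<and> l < 1 \<longrightarrow>
        f (cmb n l x y) \<ge> f x powr l * f y powr (1 - l))"

definition tukey_depth :: "nat \<Rightarrow> (nat \<Rightarrow> real) measure \<Rightarrow> (nat \<Rightarrow> real) \<Rightarrow> real" where
  "tukey_depth n \<mu> x = Inf {measure \<mu> H | H. H \<in> halfspaces n \<and> x \<in> H}"

definition cov_matrix :: "nat \<Rightarrow> (nat \<Rightarrow> real) measure \<Rightarrow> real mat" where
  "cov_matrix n \<mu> = mat n n (\<lambda>(i, j).
      integral\<^sup>L \<mu> (\<lambda>x. x i * x j) - integral\<^sup>L \<mu> (\<lambda>x. x i) * integral\<^sup>L \<mu> (\<lambda>x. x j))"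

definition iso_const :: "nat \<Rightarrow> (nat \<Rightarrow> real) measure \<Rightarrow> ((nat \<Rightarrow> real) \<Rightarrow> real) \<Rightarrow> real" where
  "iso_const n \<mu> f = (Sup (f ` space (Rn n))) powr (1 / real n) * (det (cov_matrix n \<mu>)) powr (1 / (2 * real n))"

end

theory Submission
  imports Defs
begin

text \<open>
  Let \<open>\<nu>\<close> be the law of the average of \<open>s\<close> independent copies of a vector with law \<open>\<mu>\<close>. If all the
  copies lie in a half-space \<open>H\<close>, so does their average; hence \<open>\<mu>(H)\<^sup>s \<le> \<nu>(H)\<close>, and \<open>\<phi>\<^sub>\<mu>\<^sup>s \<le> \<phi>\<^sub>\<nu>\<close>. By
  Prekopa-Leindler \<open>\<nu>\<close> has a log-concave density \<open>g\<close>. Separating \<open>x\<close> from the convex set \<open>{g > g x}\<close> gives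
  \<open>\<phi>\<^sub>\<nu>(x) \<le> sqrt (g x) * J\<close> with \<open>J\<close> the integral of \<open>sqrt g\<close>, so by Jensen
  \<open>(E \<phi>\<^sub>\<mu>)\<^sup>s \<le> E \<phi>\<^sub>\<mu>\<^sup>s \<le> (sup f) * J\<^sup>2\<close>. Log-concavity at the midpoint gives \<open>(sup g) * J\<^sup>2 \<le> 4\<^sup>n\<close>, while
  \<open>sup g\<close> is bounded below by \<open>(c * s)\<^bsup>n/2\<^esup> / sqrt (det Cov \<mu>)\<close>, because the covariance of \<open>\<nu>\<close> is that
  of \<open>\<mu>\<close> divided by \<open>s\<close>. Altogether \<open>(E \<phi>\<^sub>\<mu>)\<^sup>s \<le> (C * L / sqrt s)\<^sup>n\<close>, and \<open>s\<close> is taken of order \<open>L\<^sup>2\<close>.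
  Powers of two suffice for \<open>s\<close>, so the averaging is an iteration of the two-copy case.
\<close>

section \<open>The Prekopa-Leindler inequality\<close>

text \<open>With a single copy the method yields only a bound of the form
  \<open>(C * L) ^ n\<close>, which is useless because \<open>L\<close> is bounded below by an
  absolute constant. Averaging \<open>s\<close> copies leaves \<open>sup f\<close> alone and lowers
  the bound on \<open>J\<^sup>2\<close> for the averaged law by a factor \<open>sqrt s ^ n\<close>;
  the price is the root of order \<open>s\<close> at the end. It pays off as soon as the base
  \<open>4 * exp 1 * sqrt (pi / s) * L\<close> is at most \<open>exp (- 1)\<close>, that is,
  \<open>s \<ge> K\<^sup>2\<close> with \<open>K = 4 * exp 2 * sqrt pi * L\<close>. The root of
  \<open>exp (- n)\<close> is then \<open>exp (- n / s)\<close>, which is the source of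
  \<open>L\<^sup>2\<close> in the exponent. Rounding to a power of two costs a factor 2, so
  \<open>s \<le> 32 * exp 4 * pi * L\<^sup>2\<close>, and this coefficient gives the constant of the
  theorem. The square root of the density supplies both factors \<open>J\<close>: one comes from the
  half-space estimate at a fixed point, the other from integrating \<open>sqrt (g x)\<close> over
  that point. No separate upper bound on \<open>sup g\<close> enters, only its product with
  \<open>J\<^sup>2\<close>.\<close>

lemma emeasure_SUP_initial_segments:
  fixes A :: "real set"
  assumes [measurable]: "A \<in> sets borel" and ne: "A \<noteq> {}" and bd: "bdd_above A"
  shows "emeasure lborel A \<le> (SUP a\<in>A. emeasure lborel (A \<inter> {..a}))"
proof -
  let ?S = "Sup A"
  let ?D = "\<lambda>j::nat. A \<inter> {..?S - 1 / real (Suc j)}"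
  \<comment> \<open>The supremum need not belong to \<open>A\<close>, and if it does it adds only a
    null point; the segments cut at \<open>?S - 1 / real (Suc j)\<close> exhaust the rest.\<close>
  have "emeasure lborel A \<le> emeasure lborel ((\<Union>j. ?D j) \<union> {?S})"
  proof (rule emeasure_mono)
    show "A \<subseteq> (\<Union>j. ?D j) \<union> {?S}"
    proof
      fix x assume x: "x \<in> A"
      show "x \<in> (\<Union>j. ?D j) \<union> {?S}"
      proof (cases "x = ?S")
        case False
        with x bd have "x < ?S" using cSup_upper[of x A] by force
        then obtain j where "inverse (real (Suc j)) < ?S - x"
          using reals_Archimedean[of "?S - x"] by auto
        then have "x \<in> ?D j" using x by (auto simp: inverse_eq_divide)
        then show ?thesis by blast
      qed simp
    qed
  qed simp
  also have "\<dots> \<le> emeasure lborel (\<Union>j. ?D j) + emeasure lborel {?S}"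
    by (rule emeasure_subadditive) auto
  also have "\<dots> = emeasure lborel (\<Union>j. ?D j)" by simp
  also have "\<dots> = (SUP j. emeasure lborel (?D j))"
  proof (rule SUP_emeasure_incseq[symmetric])
    show "range ?D \<subseteq> sets lborel" by auto
    show "incseq ?D"
    proof (rule incseq_SucI)
      fix j :: nat
      have "1 / real (Suc (Suc j)) \<le> 1 / real (Suc j)" by (simp add: field_simps)
      then show "?D j \<le> ?D (Suc j)" by auto
    qed
  qed
  also have "\<dots> \<le> (SUP a\<in>A. emeasure lborel (A \<inter> {..a}))"
  proof (rule SUP_least)
    fix j :: nat
    have "?S - 1 / real (Suc j) < ?S" by simp
    then obtain a where a: "a \<in> A" "?S - 1 / real (Suc j) < a"
      using less_cSup_iff[OF ne bd] by blast
    have "emeasure lborel (?D j) \<le> emeasure lborel (A \<inter> {..a})"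
      by (rule emeasure_mono) (use a in auto)
    then show "emeasure lborel (?D j) \<le> (SUP a\<in>A. emeasure lborel (A \<inter> {..a}))"
      using a(1) by (meson SUP_upper2)
  qed
  finally show ?thesis .
qed

lemma emeasure_lborel_affine_le:
  fixes A C :: "real set"
  assumes [measurable]: "A \<in> sets borel" "C \<in> sets borel" and c: "c \<noteq> 0"
    and sub: "\<And>x. x \<in> A \<Longrightarrow> t + c * x \<in> C"
  shows "ennreal \<bar>c\<bar> * emeasure lborel A \<le> emeasure lborel C"
proof -
  have "emeasure lborel C = (\<integral>\<^sup>+x. indicator C x \<partial>lborel)" by simp
  also have "\<dots> = \<bar>c\<bar> * (\<integral>\<^sup>+x. indicator C (t + c * x) \<partial>lborel)"
    by (rule nn_integral_real_affine) (use c in auto)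
  also have "\<dots> \<ge> \<bar>c\<bar> * (\<integral>\<^sup>+x. indicator A x \<partial>lborel)"
    by (intro mult_left_mono nn_integral_mono) (auto simp: indicator_def sub)
  finally show ?thesis by simp
qed

lemma emeasure_SUP_final_segments:
  fixes B :: "real set"
  assumes B[measurable]: "B \<in> sets borel" and ne: "B \<noteq> {}" and bd: "bdd_below B"
  shows "emeasure lborel B \<le> (SUP b\<in>B. emeasure lborel (B \<inter> {b..}))"
proof -
  have refl: "emeasure lborel (uminus -` X) = emeasure lborel X" if [measurable]: "X \<in> sets borel" for X :: "real set"
  proof (rule antisym)
    have [measurable]: "uminus -` X \<in> sets borel" using measurable_sets[of uminus borel borel X] by simp
    show "emeasure lborel (uminus -` X) \<le> emeasure lborel X"
      using emeasure_lborel_affine_le[of "uminus -` X" X "-1" 0] by auto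
    show "emeasure lborel X \<le> emeasure lborel (uminus -` X)"
      using emeasure_lborel_affine_le[of X "uminus -` X" "-1" 0] by auto
  qed
  let ?A = "uminus -` B"
  have [measurable]: "?A \<in> sets borel" using measurable_sets[of uminus borel borel B] by simp
  have im: "?A = uminus ` B" by force
  have "emeasure lborel B = emeasure lborel ?A" by (simp add: refl)
  also have "\<dots> \<le> (SUP a\<in>?A. emeasure lborel (?A \<inter> {..a}))"
  proof (rule emeasure_SUP_initial_segments)
    show "?A \<noteq> {}" "bdd_above ?A" using ne bd unfolding im by auto
  qed fact
  also have "\<dots> \<le> (SUP b\<in>B. emeasure lborel (B \<inter> {b..}))"
  proof (rule SUP_least)
    fix a assume a: "a \<in> ?A"
    have "?A \<inter> {..a} = uminus -` (B \<inter> {-a..})" by auto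
    then have "emeasure lborel (?A \<inter> {..a}) = emeasure lborel (B \<inter> {-a..})"
      using refl[of "B \<inter> {-a..}"] by auto
    then show "emeasure lborel (?A \<inter> {..a}) \<le> (SUP b\<in>B. emeasure lborel (B \<inter> {b..}))"
      using a by (auto intro!: SUP_upper2[of "-a"])
  qed
  finally show ?thesis .
qed

text \<open>For \<open>a\<close> in \<open>A\<close> and \<open>b\<close> in \<open>B\<close>, a
  scaled copy of the part of \<open>A\<close> left of \<open>a\<close> and one of the part of
  \<open>B\<close> right of \<open>b\<close> fit into \<open>C\<close> on opposite sides of
  \<open>l * a + (1 - l) * b\<close>. Suprema over \<open>a\<close> and \<open>b\<close> replace the
  extreme points that a compactness argument would use. Taking \<open>C\<close> as any Borel
  superset of the sum avoids the measurability of the sum itself.\<close>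

lemma brunn_minkowski_real:
  fixes A B C :: "real set"
  assumes [measurable]: "A \<in> sets borel" "B \<in> sets borel" "C \<in> sets borel"
    and ne: "A \<noteq> {}" "B \<noteq> {}" and bd: "bounded A" "bounded B" and l: "0 < l" "l < 1"
    and sub: "\<And>x y. x \<in> A \<Longrightarrow> y \<in> B \<Longrightarrow> l * x + (1 - l) * y \<in> C"
  shows "ennreal l * emeasure lborel A + ennreal (1 - l) * emeasure lborel B \<le> emeasure lborel C"
proof -
  let ?X = "\<lambda>a. ennreal l * emeasure lborel (A \<inter> {..a})"
  let ?Y = "\<lambda>b. ennreal (1 - l) * emeasure lborel (B \<inter> {b..})"
  have pt: "?X a + ?Y b \<le> emeasure lborel C" if ab: "a \<in> A" "b \<in> B" for a b
  proof -
    let ?z = "l * a + (1 - l) * b"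
    have 1: "?X a \<le> emeasure lborel (C \<inter> {..?z})"
      using emeasure_lborel_affine_le[of "A \<inter> {..a}" "C \<inter> {..?z}" l "(1 - l) * b"] l ab sub
      by (auto simp: algebra_simps)
    have "?Y b \<le> emeasure lborel (C \<inter> {?z..})"
      using emeasure_lborel_affine_le[of "B \<inter> {b..}" "C \<inter> {?z..}" "1 - l" "l * a"] l ab sub
      by (auto simp: mult_left_mono)
    \<comment> \<open>The common point \<open>?z\<close> is dropped from the right-hand piece at no
      cost in measure, so that the two pieces become disjoint.\<close>
    also have "\<dots> \<le> emeasure lborel (C \<inter> {?z<..} \<union> {?z})"
      by (rule emeasure_mono) auto
    also have "\<dots> \<le> emeasure lborel (C \<inter> {?z<..}) + emeasure lborel {?z}"
      by (rule emeasure_subadditive) auto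
    finally have 2: "?Y b \<le> emeasure lborel (C \<inter> {?z<..})" by simp
    have "?X a + ?Y b \<le> emeasure lborel (C \<inter> {..?z}) + emeasure lborel (C \<inter> {?z<..})"
      by (rule add_mono[OF 1 2])
    also have "\<dots> = emeasure lborel (C \<inter> {..?z} \<union> C \<inter> {?z<..})"
      by (rule plus_emeasure) auto
    also have "C \<inter> {..?z} \<union> C \<inter> {?z<..} = C" by auto
    finally show ?thesis .
  qed
  have "ennreal l * emeasure lborel A + ennreal (1 - l) * emeasure lborel B
      \<le> ennreal l * (SUP a\<in>A. emeasure lborel (A \<inter> {..a})) + ennreal (1 - l) * (SUP b\<in>B. emeasure lborel (B \<inter> {b..}))"
    using bd by (intro add_mono mult_left_mono emeasure_SUP_initial_segments emeasure_SUP_final_segments)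
      (auto simp: ne bounded_imp_bdd_above bounded_imp_bdd_below)
  also have "\<dots> = (SUP a\<in>A. ?X a) + (SUP b\<in>B. ?Y b)"
    by (simp add: SUP_mult_left_ennreal)
  also have "\<dots> = (SUP b\<in>B. SUP a\<in>A. ?X a + ?Y b)"
    by (simp only: ennreal_SUP_add_left[OF ne(1), symmetric] ennreal_SUP_add_right[OF ne(2)])
  also have "\<dots> \<le> emeasure lborel C"
    by (intro SUP_least pt)
  finally show ?thesis .
qed

section \<open>From sets to functions: Prekopa-Leindler on the real line\<close>

text \<open>The relation \<open>A\<^sup>l B\<^sup>1\<^sup>-\<^sup>l \<le> C\<close> on extended reals, phrased so that it needs no convention for
  \<open>0 \<cdot> \<infinity>\<close> and passes to suprema in \<open>A\<close> and \<open>B\<close>.\<close>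

definition geo_le :: "real \<Rightarrow> ennreal \<Rightarrow> ennreal \<Rightarrow> ennreal \<Rightarrow> bool" where
  "geo_le l A B C \<longleftrightarrow> (\<forall>a b. 0 < a \<longrightarrow> 0 < b \<longrightarrow> ennreal a < A \<longrightarrow> ennreal b < B \<longrightarrow>
     ennreal (a powr l * b powr (1 - l)) \<le> C)"

lemma geo_leD:
  "geo_le l A B C \<Longrightarrow> 0 < a \<Longrightarrow> 0 < b \<Longrightarrow> ennreal a < A \<Longrightarrow> ennreal b < B \<Longrightarrow>
     ennreal (a powr l * b powr (1 - l)) \<le> C"
  unfolding geo_le_def by blast

lemma geo_le_ennrealI:
  assumes "0 < l" "l < 1" "A powr l * B powr (1 - l) \<le> C"
  shows "geo_le l (ennreal A) (ennreal B) (ennreal C)"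
  unfolding geo_le_def
proof (intro allI impI)
  fix a b :: real assume ab: "0 < a" "0 < b" "ennreal a < ennreal A" "ennreal b < ennreal B"
  then have "a \<le> A" "b \<le> B" by (auto simp: ennreal_less_iff)
  then have "a powr l * b powr (1 - l) \<le> A powr l * B powr (1 - l)"
    using ab assms by (intro mult_mono powr_mono2) auto
  with assms show "ennreal (a powr l * b powr (1 - l)) \<le> ennreal C" by (simp add: ennreal_leI)
qed

lemma geo_le_ennrealD:
  assumes l: "0 < l" "l < 1" and g: "geo_le l (ennreal A) (ennreal B) (ennreal C)" and C: "0 \<le> C"
    and AB: "0 \<le> A" "0 \<le> B"
  shows "A powr l * B powr (1 - l) \<le> C"
proof (cases "A = 0 \<or> B = 0")
  case False
  with AB have pos: "0 < A" "0 < B" by auto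
  \<comment> \<open>\<open>geo_le\<close> speaks only of values strictly below \<open>A\<close> and
    \<open>B\<close>; the values \<open>r * A\<close> and \<open>r * B\<close> with \<open>r\<close>
    tending to 1 from below recover the endpoint.\<close>
  have "((\<lambda>r. (r * A) powr l * (r * B) powr (1 - l)) \<longlongrightarrow> (1 * A) powr l * (1 * B) powr (1 - l)) (at_left 1)"
    using pos by (intro tendsto_intros) auto
  moreover have "\<forall>\<^sub>F r in at_left 1. (r * A) powr l * (r * B) powr (1 - l) \<le> C"
  proof -
    have "(r * A) powr l * (r * B) powr (1 - l) \<le> C" if "r \<in> {0<..<1}" for r :: real
      using geo_leD[OF g, of "r * A" "r * B"] that pos C by (auto simp: ennreal_less_iff)
    then show ?thesis
      using eventually_at_left_real[of 0 "1::real"] by (auto elim: eventually_mono)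
  qed
  ultimately show ?thesis
    using tendsto_upperbound by fastforce
qed (use C l in auto)

text \<open>Half of the layer-cake formula. Keeping only the levels between 0 and 1 lowers the left
  side, which is harmless for the dominating function; the dominated ones will be normalised to
  values at most 1 and have no higher levels.\<close>

lemma nn_integral_level_sets_le:
  fixes h :: "real \<Rightarrow> ennreal"
  assumes [measurable]: "h \<in> borel_measurable borel"
  shows "(\<integral>\<^sup>+t. indicator {0<..<1} t * emeasure lborel {x. ennreal t \<le> h x} \<partial>lborel) \<le> (\<integral>\<^sup>+x. h x \<partial>lborel)"
proof -
  have "(\<integral>\<^sup>+t. indicator {0<..<1} t * emeasure lborel {x. ennreal t \<le> h x} \<partial>lborel)
      = (\<integral>\<^sup>+t. (\<integral>\<^sup>+x. indicator {0<..<1} t * indicator {x. ennreal t \<le> h x} x \<partial>lborel) \<partial>lborel)"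
    by (intro nn_integral_cong, subst nn_integral_cmult) auto
  also have "\<dots> = (\<integral>\<^sup>+x. (\<integral>\<^sup>+t. indicator {0<..<1} t * indicator {x. ennreal t \<le> h x} x \<partial>lborel) \<partial>lborel)"
    by (rule lborel_pair.Fubini') measurable
  also have "\<dots> \<le> (\<integral>\<^sup>+x. h x \<partial>lborel)"
  proof (rule nn_integral_mono)
    fix x
    show "(\<integral>\<^sup>+t. indicator {0<..<1} t * indicator {x. ennreal t \<le> h x} x \<partial>lborel) \<le> h x"
    proof (cases "h x")
      case (real r)
      have "(\<integral>\<^sup>+t. indicator {0<..<1} t * indicator {x. ennreal t \<le> h x} x \<partial>lborel)
          \<le> (\<integral>\<^sup>+t. indicator {0..r} t \<partial>lborel)"
        by (intro nn_integral_mono) (auto simp: indicator_def real)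
      then show ?thesis using real by simp
    qed simp
  qed
  finally show ?thesis .
qed

lemma nn_integral_level_sets_ge:
  fixes h :: "real \<Rightarrow> real"
  assumes [measurable]: "h \<in> borel_measurable borel" and h: "\<And>x. 0 \<le> h x" "\<And>x. h x \<le> 1"
  shows "(\<integral>\<^sup>+x. ennreal (h x) \<partial>lborel) \<le> (\<integral>\<^sup>+t. indicator {0<..<1} t * emeasure lborel {x. t < h x} \<partial>lborel)"
proof -
  have "(\<integral>\<^sup>+x. ennreal (h x) \<partial>lborel)
    \<le> (\<integral>\<^sup>+x. (\<integral>\<^sup>+t. indicator {0<..<1} t * indicator {x. t < h x} x \<partial>lborel) \<partial>lborel)"
  proof (rule nn_integral_mono)
    fix x
    have "ennreal (h x) = (\<integral>\<^sup>+t. indicator {0<..<h x} t \<partial>lborel)" using h[of x] by simp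
    also have "\<dots> \<le> (\<integral>\<^sup>+t. indicator {0<..<1} t * indicator {x. t < h x} x \<partial>lborel)"
      using h[of x] by (intro nn_integral_mono) (auto simp: indicator_def)
    finally show "ennreal (h x) \<le> \<dots>" .
  qed
  also have "\<dots> = (\<integral>\<^sup>+t. (\<integral>\<^sup>+x. indicator {0<..<1} t * indicator {x. t < h x} x \<partial>lborel) \<partial>lborel)"
    by (rule lborel_pair.Fubini') measurable
  also have "\<dots> = (\<integral>\<^sup>+t. indicator {0<..<1} t * emeasure lborel {x. t < h x} \<partial>lborel)"
    by (intro nn_integral_cong, subst nn_integral_cmult) auto
  finally show ?thesis .
qed

text \<open>Dividing by the suprema \<open>P\<close> and \<open>Q\<close> makes the level sets of
  both functions nonempty at every level below 1, as Brunn-Minkowski requires. Integrating over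
  levels gives an additive inequality for the normalised functions, and the weighted
  arithmetic-geometric mean inequality turns it back into the multiplicative one.\<close>

lemma prekopa_leindler_bounded:
  fixes p q :: "real \<Rightarrow> real" and w :: "real \<Rightarrow> ennreal"
  assumes [measurable]: "p \<in> borel_measurable borel" "q \<in> borel_measurable borel" "w \<in> borel_measurable borel"
    and l: "0 < l" "l < 1"
    and p: "\<And>x. 0 \<le> p x" "\<And>x. p x \<le> N" "\<And>x. \<bar>x\<bar> > N \<Longrightarrow> p x = 0"
    and q: "\<And>x. 0 \<le> q x" "\<And>x. q x \<le> N" "\<And>x. \<bar>x\<bar> > N \<Longrightarrow> q x = 0"
    and w: "\<And>x y. geo_le l (ennreal (p x)) (ennreal (q y)) (w (l * x + (1 - l) * y))"
  shows "geo_le l (\<integral>\<^sup>+x. ennreal (p x) \<partial>lborel) (\<integral>\<^sup>+x. ennreal (q x) \<partial>lborel) (\<integral>\<^sup>+x. w x \<partial>lborel)"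
  unfolding geo_le_def
proof (intro allI impI)
  fix a b :: real
  assume ab: "0 < a" "0 < b" "ennreal a < (\<integral>\<^sup>+x. ennreal (p x) \<partial>lborel)" "ennreal b < (\<integral>\<^sup>+x. ennreal (q x) \<partial>lborel)"
  define P where "P = (SUP x. p x)"
  define Q where "Q = (SUP x. q x)"
  have bdd: "bdd_above (range p)" "bdd_above (range q)" using p(2) q(2) by (auto intro!: bdd_aboveI)
  have pP: "p x \<le> P" and qQ: "q x \<le> Q" for x
    unfolding P_def Q_def using bdd by (auto intro: cSUP_upper)
  have "P > 0"
  proof (rule ccontr)
    assume "\<not> 0 < P"
    then have "p x = 0" for x using pP[of x] p(1)[of x] by linarith
    with ab show False by simp
  qed
  moreover have "Q > 0"
  proof (rule ccontr)
    assume "\<not> 0 < Q"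
    then have "q x = 0" for x using qQ[of x] q(1)[of x] by linarith
    with ab show False by simp
  qed
  ultimately have PQ: "P > 0" "Q > 0" .
  define W where "W = P powr l * Q powr (1 - l)"
  have W: "W > 0" using PQ by (simp add: W_def)
  have scale: "(\<integral>\<^sup>+x. ennreal (f x / F) \<partial>lborel) = ennreal (1 / F) * (\<integral>\<^sup>+x. ennreal (f x) \<partial>lborel)"
    if [measurable]: "f \<in> borel_measurable borel" and "F > 0" for f :: "real \<Rightarrow> real" and F
    using that by (subst nn_integral_cmult[symmetric]) (auto simp: ennreal_mult'[symmetric])
  have lev: "ennreal l * emeasure lborel {x. t < p x / P} + ennreal (1 - l) * emeasure lborel {x. t < q x / Q}
      \<le> emeasure lborel {x. ennreal t \<le> w x / ennreal W}" if t: "0 < t" "t < 1" for t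
  proof (rule brunn_minkowski_real)
    show "{x. t < p x / P} \<in> sets borel" "{x. t < q x / Q} \<in> sets borel"
      "{x. ennreal t \<le> w x / ennreal W} \<in> sets borel" by measurable
    have "t * P < P" using t PQ by simp
    then obtain x where "t * P < p x" unfolding P_def using less_cSUP_iff[OF _ bdd(1)] by auto
    then show "{x. t < p x / P} \<noteq> {}" using PQ by (auto simp: field_simps)
    have "t * Q < Q" using t PQ by simp
    then obtain x where "t * Q < q x" unfolding Q_def using less_cSUP_iff[OF _ bdd(2)] by auto
    then show "{x. t < q x / Q} \<noteq> {}" using PQ by (auto simp: field_simps)
    have "{x. t < p x / P} \<subseteq> {-N..N}" "{x. t < q x / Q} \<subseteq> {-N..N}"
      using p(3) q(3) t by (auto, (smt (verit) div_0)+)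
    then show "bounded {x. t < p x / P}" "bounded {x. t < q x / Q}"
      using bounded_subset bounded_closed_interval by blast+
    show "0 < l" "l < 1" by fact+
  next
    fix x y assume "x \<in> {x. t < p x / P}" "y \<in> {x. t < q x / Q}"
    then have "t * P < p x" "t * Q < q y" using PQ by (auto simp: field_simps)
    then have "ennreal ((t * P) powr l * (t * Q) powr (1 - l)) \<le> w (l * x + (1 - l) * y)"
      using t PQ by (intro geo_leD[OF w]) (auto simp: ennreal_less_iff)
    \<comment> \<open>The exponents sum to 1, so level \<open>t\<close> of both normalised functions
      leads to the same level \<open>t\<close> of \<open>w / W\<close>.\<close>
    also have "(t * P) powr l * (t * Q) powr (1 - l) = t * W"
      using t PQ by (simp add: powr_mult W_def powr_add[symmetric] mult_ac)
    finally have "ennreal (t * W) / ennreal W \<le> w (l * x + (1 - l) * y) / ennreal W"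
      by (rule divide_right_mono_ennreal)
    then show "l * x + (1 - l) * y \<in> {x. ennreal t \<le> w x / ennreal W}"
      using W t by (simp add: divide_ennreal)
  qed
  have "ennreal (l * (a / P) + (1 - l) * (b / Q))
      = ennreal l * (ennreal (1 / P) * ennreal a) + ennreal (1 - l) * (ennreal (1 / Q) * ennreal b)"
    using l PQ ab by (simp add: ennreal_mult'[symmetric] ennreal_plus[symmetric] del: ennreal_plus)
  also have "\<dots> \<le> ennreal l * (\<integral>\<^sup>+x. ennreal (p x / P) \<partial>lborel) + ennreal (1 - l) * (\<integral>\<^sup>+x. ennreal (q x / Q) \<partial>lborel)"
    using ab PQ by (subst (1 2) scale) (auto intro!: add_mono mult_left_mono)
  also have "\<dots> \<le> ennreal l * (\<integral>\<^sup>+t. indicator {0<..<1} t * emeasure lborel {x. t < p x / P} \<partial>lborel)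
      + ennreal (1 - l) * (\<integral>\<^sup>+t. indicator {0<..<1} t * emeasure lborel {x. t < q x / Q} \<partial>lborel)"
    using PQ p q pP qQ by (intro add_mono mult_left_mono nn_integral_level_sets_ge) auto
  also have "\<dots> = (\<integral>\<^sup>+t. indicator {0<..<1} t * (ennreal l * emeasure lborel {x. t < p x / P}
      + ennreal (1 - l) * emeasure lborel {x. t < q x / Q}) \<partial>lborel)"
    by (subst (1 2) nn_integral_cmult[symmetric], measurable, subst nn_integral_add[symmetric])
      (auto simp: distrib_left mult_ac)
  also have "\<dots> \<le> (\<integral>\<^sup>+t. indicator {0<..<1} t * emeasure lborel {x. ennreal t \<le> w x / ennreal W} \<partial>lborel)"
    by (intro nn_integral_mono) (auto simp: indicator_def lev)
  also have "\<dots> \<le> (\<integral>\<^sup>+x. w x / ennreal W \<partial>lborel)"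
    by (rule nn_integral_level_sets_le) measurable
  also have "\<dots> = (\<integral>\<^sup>+x. w x \<partial>lborel) / ennreal W"
    by (rule nn_integral_divide) measurable
  finally have main: "ennreal (l * (a / P) + (1 - l) * (b / Q)) \<le> (\<integral>\<^sup>+x. w x \<partial>lborel) / ennreal W" .
  have "a powr l * b powr (1 - l) = W * ((a / P) powr l * (b / Q) powr (1 - l))"
    using ab PQ by (simp add: W_def powr_divide)
  also have "\<dots> \<le> W * (l * (a / P) + (1 - l) * (b / Q))"
    using W l ab PQ by (intro mult_left_mono Youngs_inequality_0) auto
  finally have "ennreal (a powr l * b powr (1 - l)) \<le> ennreal W * ennreal (l * (a / P) + (1 - l) * (b / Q))"
    using W by (simp add: ennreal_mult'[symmetric] ennreal_leI)
  also have "\<dots> \<le> ennreal W * ((\<integral>\<^sup>+x. w x \<partial>lborel) / ennreal W)"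
    by (intro mult_left_mono main) simp
  also have "\<dots> = (\<integral>\<^sup>+x. w x \<partial>lborel)"
    using W by (simp add: ennreal_times_divide mult.commute[of "ennreal W"] ennreal_mult_divide_eq)
  finally show "ennreal (a powr l * b powr (1 - l)) \<le> (\<integral>\<^sup>+x. w x \<partial>lborel)" .
qed

lemma prekopa_leindler_real:
  fixes u v w :: "real \<Rightarrow> ennreal"
  assumes [measurable]: "u \<in> borel_measurable borel" "v \<in> borel_measurable borel" "w \<in> borel_measurable borel"
    and l: "0 < l" "l < 1"
    and w: "\<And>x y. geo_le l (u x) (v y) (w (l * x + (1 - l) * y))"
  shows "geo_le l (\<integral>\<^sup>+x. u x \<partial>lborel) (\<integral>\<^sup>+x. v x \<partial>lborel) (\<integral>\<^sup>+x. w x \<partial>lborel)"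
proof -
  \<comment> \<open>Truncation in height and in support meets the hypotheses of the bounded case and
    converges monotonically. Lowering the first two arguments only weakens \<open>geo_le\<close>, so
    the assumption on \<open>w\<close> survives it.\<close>
  define tr :: "(real \<Rightarrow> ennreal) \<Rightarrow> nat \<Rightarrow> real \<Rightarrow> ennreal"
    where "tr f N x = min (f x) (ennreal (real N)) * indicator {- real N..real N} x" for f N x
  have mono: "incseq (tr f)" for f
    unfolding incseq_def le_fun_def tr_def
    by (intro allI impI mult_mono min.mono) (auto simp: indicator_def)
  have sup: "(SUP N. tr f N x) = f x" for f x
  proof (rule antisym)
    show "(SUP N. tr f N x) \<le> f x" by (rule SUP_least) (auto simp: tr_def indicator_def)
    show "f x \<le> (SUP N. tr f N x)"
    proof (rule dense_le)
      fix y assume y: "y < f x"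
      then have "y < Orderings.top" using order.strict_trans2 top_greatest by blast
      then obtain N where N: "y < of_nat N" using ennreal_Ex_less_of_nat by blast
      obtain N' where N': "\<bar>x\<bar> \<le> real N'" using real_arch_simple by blast
      let ?K = "max N N'"
      have "y \<le> of_nat ?K" using N by (meson less_imp_le max.cobounded1 of_nat_mono order_trans)
      moreover have "x \<in> {- real ?K..real ?K}" using N' by auto
      ultimately have "y \<le> tr f ?K x" using y by (simp add: tr_def ennreal_of_nat_eq_real_of_nat)
      then show "y \<le> (SUP N. tr f N x)" by (rule SUP_upper2[rotated]) simp
    qed
  qed
  have lim: "\<exists>N0. \<forall>N\<ge>N0. a < (\<integral>\<^sup>+x. tr f N x \<partial>lborel)"
    if a: "a < (\<integral>\<^sup>+x. f x \<partial>lborel)" and [measurable]: "f \<in> borel_measurable borel" for f a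
  proof -
    have "(\<integral>\<^sup>+x. f x \<partial>lborel) = (\<integral>\<^sup>+x. (SUP N. tr f N x) \<partial>lborel)" by (simp add: sup)
    also have "\<dots> = (SUP N. (\<integral>\<^sup>+x. tr f N x \<partial>lborel))"
      by (rule nn_integral_monotone_convergence_SUP[OF mono]) (simp add: tr_def[abs_def])
    finally have "(\<integral>\<^sup>+x. f x \<partial>lborel) = (SUP N. (\<integral>\<^sup>+x. tr f N x \<partial>lborel))" .
    then obtain N0 where N0: "a < (\<integral>\<^sup>+x. tr f N0 x \<partial>lborel)"
      using a by (auto simp: less_SUP_iff)
    moreover have "(\<integral>\<^sup>+x. tr f N0 x \<partial>lborel) \<le> (\<integral>\<^sup>+x. tr f N x \<partial>lborel)" if "N \<ge> N0" for N
      by (intro nn_integral_mono) (use mono[of f] that in \<open>auto simp: incseq_def le_fun_def\<close>)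
    ultimately show ?thesis by (metis order_less_le_trans)
  qed
  have fin: "tr f N x = ennreal (enn2real (tr f N x))" for f N x
    by (rule ennreal_enn2real[symmetric]) (auto simp: tr_def indicator_def min_less_iff_disj)
  have le: "enn2real (tr f N x) \<le> real N" for f N x
    by (rule enn2real_leI) (auto simp: tr_def indicator_def)
  have zero: "enn2real (tr f N x) = 0" if "\<bar>x\<bar> > real N" for f N x
    using that by (auto simp: tr_def indicator_def)
  have le_f: "tr f N x \<le> f x" for f N x
    by (auto simp: tr_def indicator_def)
  show ?thesis
    unfolding geo_le_def
  proof (intro allI impI)
    fix a b :: real
    assume ab: "0 < a" "0 < b" "ennreal a < (\<integral>\<^sup>+x. u x \<partial>lborel)" "ennreal b < (\<integral>\<^sup>+x. v x \<partial>lborel)"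
    obtain N where N: "ennreal a < (\<integral>\<^sup>+x. tr u N x \<partial>lborel)" "ennreal b < (\<integral>\<^sup>+x. tr v N x \<partial>lborel)"
      using lim[OF ab(3)] lim[OF ab(4)] by (metis assms(1,2) nle_le)
    have [measurable]: "(\<lambda>x. enn2real (tr u N x)) \<in> borel_measurable borel"
      "(\<lambda>x. enn2real (tr v N x)) \<in> borel_measurable borel"
      by (simp_all add: tr_def[abs_def])
    have "geo_le l (\<integral>\<^sup>+x. ennreal (enn2real (tr u N x)) \<partial>lborel) (\<integral>\<^sup>+x. ennreal (enn2real (tr v N x)) \<partial>lborel)
        (\<integral>\<^sup>+x. w x \<partial>lborel)"
    proof (rule prekopa_leindler_bounded[where N="real N"])
      show "geo_le l (ennreal (enn2real (tr u N x))) (ennreal (enn2real (tr v N y))) (w (l * x + (1 - l) * y))" for x y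
        unfolding fin[symmetric] using w[of x y] le_f unfolding geo_le_def by (meson order_less_le_trans)
    qed (use l le zero in auto)
    then show "ennreal (a powr l * b powr (1 - l)) \<le> (\<integral>\<^sup>+x. w x \<partial>lborel)"
      unfolding fin[symmetric] using geo_leD ab N by blast
  qed
qed

section \<open>Integration on \<open>\<real>\<^sup>n\<close>\<close>

interpretation lborel_product: product_sigma_finite "\<lambda>_::nat. lborel :: real measure"
  by standard

lemma space_Rn: "space (Rn n) = ({..<n} \<rightarrow>\<^sub>E UNIV)"
  by (simp add: Rn_def space_PiM)

lemma restrict_in_space_Rn [simp, intro]: "restrict h {..<n} \<in> space (Rn n)"
  by (simp add: space_Rn)

lemma cmb_in_space_Rn [simp, intro]: "cmb n l x y \<in> space (Rn n)"
  by (simp add: cmb_def)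

lemma space_Rn_eqI:
  assumes "x \<in> space (Rn n)" "y \<in> space (Rn n)" "\<And>i. i < n \<Longrightarrow> x i = y i"
  shows "x = y"
  using assms by (auto simp: space_Rn intro: PiE_ext)

lemma cmb_apply [simp]: "i < n \<Longrightarrow> cmb n l x y i = l * x i + (1 - l) * y i"
  by (simp add: cmb_def)

lemma sigma_finite_Rn: "sigma_finite_measure (Rn n)"
  unfolding Rn_def by (rule lborel_product.sigma_finite) simp

lemma measurable_Rn_component [measurable]: "i < n \<Longrightarrow> (\<lambda>x. x i) \<in> borel_measurable (Rn n)"
  using measurable_component_singleton[of i "{..<n}" "\<lambda>_. lborel :: real measure"] by (simp add: Rn_def)

lemma measurable_into_Rn:
  assumes "\<And>i. i < n \<Longrightarrow> (\<lambda>x. X x i) \<in> borel_measurable N"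
  shows "(\<lambda>x. restrict (X x) {..<n}) \<in> N \<rightarrow>\<^sub>M Rn n"
  unfolding Rn_def restrict_def[abs_def] using assms
  by (intro measurable_restrict[unfolded restrict_def[abs_def]]) simp

lemma nn_integral_Rn_Suc:
  assumes "h \<in> borel_measurable (Rn (Suc n))"
  shows "(\<integral>\<^sup>+x. h x \<partial>Rn (Suc n)) = (\<integral>\<^sup>+x. (\<integral>\<^sup>+y. h (x(n := y)) \<partial>lborel) \<partial>Rn n)"
  using assms unfolding Rn_def lessThan_Suc by (intro lborel_product.product_nn_integral_insert) auto

lemma nn_integral_Rn_0: "(\<integral>\<^sup>+x. h x \<partial>Rn 0) = h (\<lambda>_. undefined)"
  by (simp add: Rn_def nn_integral_count_space_finite PiM_empty)

lemma fun_upd_in_space_Rn [simp, intro]: "x \<in> space (Rn n) \<Longrightarrow> x(n := y) \<in> space (Rn (Suc n))"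
  by (auto simp: space_Rn PiE_def extensional_def)

lemma measurable_fun_upd_Rn [measurable]:
  "(\<lambda>(x, y). x(n := y)) \<in> Rn n \<Otimes>\<^sub>M borel \<rightarrow>\<^sub>M Rn (Suc n)"
proof -
  have "(\<lambda>(x, y). x(n := y)) \<in> Rn n \<Otimes>\<^sub>M lborel \<rightarrow>\<^sub>M Rn (Suc n)"
    unfolding Rn_def lessThan_Suc by (rule measurable_add_dim)
  then show ?thesis by (simp cong: measurable_cong_sets)
qed

lemma measurable_fun_upd_Rn_snd:
  "x \<in> space (Rn n) \<Longrightarrow> (\<lambda>y. x(n := y)) \<in> borel \<rightarrow>\<^sub>M Rn (Suc n)"
  using measurable_compose[OF measurable_Pair1' measurable_fun_upd_Rn[of n]] by simp

lemma borel_measurable_fiber_integral: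
  fixes h :: "(nat \<Rightarrow> real) \<Rightarrow> ennreal"
  assumes [measurable]: "h \<in> borel_measurable (Rn (Suc n))"
  shows "(\<lambda>x. \<integral>\<^sup>+y. h (x(n := y)) \<partial>lborel) \<in> borel_measurable (Rn n)"
proof -
  have [measurable]: "(\<lambda>(x, y). h (x(n := y))) \<in> borel_measurable (Rn n \<Otimes>\<^sub>M lborel)"
    using measurable_compose[OF measurable_fun_upd_Rn assms]
    by (simp add: case_prod_beta cong: measurable_cong_sets)
  show ?thesis
    using sigma_finite_measure.borel_measurable_nn_integral[OF sigma_finite_lborel, of "\<lambda>x y. h (x(n := y))" "Rn n"]
    by simp
qed

text \<open>Induction on the dimension: by the one-dimensional case the integrals over the last
  coordinate again satisfy the hypothesis. These fibre integrals may be infinite, which is why the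
  relation is phrased for \<open>ennreal\<close>.\<close>

lemma prekopa_leindler:
  fixes u v w :: "(nat \<Rightarrow> real) \<Rightarrow> ennreal"
  assumes "u \<in> borel_measurable (Rn n)" "v \<in> borel_measurable (Rn n)" "w \<in> borel_measurable (Rn n)"
    and l: "0 < l" "l < 1"
    and "\<And>x y. x \<in> space (Rn n) \<Longrightarrow> y \<in> space (Rn n) \<Longrightarrow> geo_le l (u x) (v y) (w (cmb n l x y))"
  shows "geo_le l (\<integral>\<^sup>+x. u x \<partial>Rn n) (\<integral>\<^sup>+x. v x \<partial>Rn n) (\<integral>\<^sup>+x. w x \<partial>Rn n)"
  using assms(1-3,6)
proof (induction n arbitrary: u v w)
  case 0
  have "cmb 0 l x y = (\<lambda>_. undefined)" for x y by (simp add: cmb_def fun_eq_iff)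
  moreover have "(\<lambda>_. undefined) \<in> space (Rn 0)" by (simp add: space_Rn)
  ultimately show ?case using 0 by (simp add: nn_integral_Rn_0)
next
  case (Suc n)
  show ?case
    unfolding nn_integral_Rn_Suc[OF Suc.prems(1)] nn_integral_Rn_Suc[OF Suc.prems(2)] nn_integral_Rn_Suc[OF Suc.prems(3)]
  proof (rule Suc.IH)
    fix x y assume xy: "x \<in> space (Rn n)" "y \<in> space (Rn n)"
    show "geo_le l (\<integral>\<^sup>+s. u (x(n := s)) \<partial>lborel) (\<integral>\<^sup>+s. v (y(n := s)) \<partial>lborel)
        (\<integral>\<^sup>+s. w ((cmb n l x y)(n := s)) \<partial>lborel)"
    proof (rule prekopa_leindler_real[OF _ _ _ l])
      fix s t :: real
      have eq: "cmb (Suc n) l (x(n := s)) (y(n := t)) = (cmb n l x y)(n := l * s + (1 - l) * t)"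
        by (auto simp: cmb_def less_Suc_eq)
      show "geo_le l (u (x(n := s))) (v (y(n := t))) (w ((cmb n l x y)(n := l * s + (1 - l) * t)))"
        using Suc.prems(4)[OF fun_upd_in_space_Rn[OF xy(1)] fun_upd_in_space_Rn[OF xy(2)], of s t] unfolding eq .
    qed (use xy Suc.prems in \<open>auto intro!: measurable_compose[OF measurable_fun_upd_Rn_snd]\<close>)
  qed (intro borel_measurable_fiber_integral Suc.prems)+
qed

lemma nn_integral_Rn_affine:
  fixes h :: "(nat \<Rightarrow> real) \<Rightarrow> ennreal"
  assumes "h \<in> borel_measurable (Rn n)" and c: "c \<noteq> 0"
  shows "(\<integral>\<^sup>+x. h x \<partial>Rn n) = ennreal (\<bar>c\<bar> ^ n) * (\<integral>\<^sup>+x. h (restrict (\<lambda>i. t i + c * x i) {..<n}) \<partial>Rn n)"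
  using assms(1)
proof (induction n arbitrary: h)
  case 0
  show ?case unfolding nn_integral_Rn_0 by (simp add: restrict_def)
next
  case (Suc n)
  let ?r = "\<lambda>x. restrict (\<lambda>i. t i + c * x i) {..<n}"
  have upd: "restrict (\<lambda>i. t i + c * (x(n := y)) i) {..<Suc n} = (?r x)(n := t n + c * y)" for x y
    by (auto simp: less_Suc_eq)
  have m: "(\<lambda>x. restrict (\<lambda>i. t i + c * x i) {..<k}) \<in> Rn k \<rightarrow>\<^sub>M Rn k" for k
    by (rule measurable_into_Rn) measurable
  have "(\<integral>\<^sup>+x. h x \<partial>Rn (Suc n)) = (\<integral>\<^sup>+x. (\<integral>\<^sup>+y. h (x(n := y)) \<partial>lborel) \<partial>Rn n)"
    by (rule nn_integral_Rn_Suc) fact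
  also have "\<dots> = ennreal (\<bar>c\<bar> ^ n) * (\<integral>\<^sup>+x. (\<integral>\<^sup>+y. h ((?r x)(n := y)) \<partial>lborel) \<partial>Rn n)"
    by (intro Suc.IH borel_measurable_fiber_integral Suc.prems)
  also have "(\<integral>\<^sup>+x. (\<integral>\<^sup>+y. h ((?r x)(n := y)) \<partial>lborel) \<partial>Rn n)
      = (\<integral>\<^sup>+x. ennreal \<bar>c\<bar> * (\<integral>\<^sup>+y. h ((?r x)(n := t n + c * y)) \<partial>lborel) \<partial>Rn n)"
    by (intro nn_integral_cong nn_integral_real_affine c measurable_compose[OF measurable_fun_upd_Rn_snd Suc.prems]) auto
  also have "\<dots> = ennreal \<bar>c\<bar> * (\<integral>\<^sup>+x. (\<integral>\<^sup>+y. h ((?r x)(n := t n + c * y)) \<partial>lborel) \<partial>Rn n)"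
    unfolding upd[symmetric]
    by (intro nn_integral_cmult borel_measurable_fiber_integral measurable_compose[OF m] Suc.prems)
  also have "(\<integral>\<^sup>+x. (\<integral>\<^sup>+y. h ((?r x)(n := t n + c * y)) \<partial>lborel) \<partial>Rn n)
     = (\<integral>\<^sup>+x. h (restrict (\<lambda>i. t i + c * x i) {..<Suc n}) \<partial>Rn (Suc n))"
    unfolding upd[symmetric]
    by (intro nn_integral_Rn_Suc[symmetric] measurable_compose[OF m] Suc.prems)
  finally show ?case by (simp only: power_Suc ennreal_mult[OF abs_ge_zero zero_le_power[OF abs_ge_zero]] mult_ac)
qed

section \<open>Log-concave densities\<close>

locale logconcave_prob = prob_space \<mu> for \<mu> :: "(nat \<Rightarrow> real) measure" +
  fixes n :: nat and f :: "(nat \<Rightarrow> real) \<Rightarrow> real"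
  assumes logconcave: "logconcave_density n \<mu> f"
begin

lemma density_measurable [measurable]: "f \<in> borel_measurable (Rn n)"
  and density_nonneg: "x \<in> space (Rn n) \<Longrightarrow> 0 \<le> f x"
  and \<mu>_eq: "\<mu> = density (Rn n) (\<lambda>x. ennreal (f x))"
  and density_cmb: "x \<in> space (Rn n) \<Longrightarrow> y \<in> space (Rn n) \<Longrightarrow> 0 < l \<Longrightarrow> l < 1 \<Longrightarrow>
     f x powr l * f y powr (1 - l) \<le> f (cmb n l x y)"
  using logconcave unfolding logconcave_density_def by auto

lemma sets_eq [measurable_cong]: "sets \<mu> = sets (Rn n)"
  by (subst \<mu>_eq) simp

lemma space_eq: "space \<mu> = space (Rn n)"
  by (subst \<mu>_eq) simp

lemma nn_integral_eq:
  "h \<in> borel_measurable (Rn n) \<Longrightarrow> (\<integral>\<^sup>+x. h x \<partial>\<mu>) = (\<integral>\<^sup>+x. ennreal (f x) * h x \<partial>Rn n)"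
  by (subst \<mu>_eq) (simp add: nn_integral_density)

lemma nn_integral_density_1: "(\<integral>\<^sup>+x. ennreal (f x) \<partial>Rn n) = 1"
  using nn_integral_eq[of "\<lambda>_. 1"] emeasure_space_1 by simp

definition root_integral :: ennreal where
  "root_integral = (\<integral>\<^sup>+x. ennreal (sqrt (f x)) \<partial>Rn n)"

text \<open>Every \<open>u\<close> is the midpoint of \<open>x0\<close> and its reflection
  \<open>2 * u - x0\<close>, so log-concavity bounds the product of the two square roots by
  \<open>f u\<close>, whose integral is 1. The substitution has Jacobian
  \<open>2 ^ n\<close>.\<close>

lemma sqrt_density_times_root_integral:
  assumes x0: "x0 \<in> space (Rn n)"
  shows "ennreal (sqrt (f x0)) * root_integral \<le> ennreal (2 ^ n)"
proof -
  let ?r = "\<lambda>u. restrict (\<lambda>i. - x0 i + 2 * u i) {..<n}"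
  have m: "?r \<in> Rn n \<rightarrow>\<^sub>M Rn n" by (rule measurable_into_Rn) measurable
  have "root_integral = ennreal (2 ^ n) * (\<integral>\<^sup>+u. ennreal (sqrt (f (?r u))) \<partial>Rn n)"
    unfolding root_integral_def by (subst nn_integral_Rn_affine[of _ _ 2 "\<lambda>i. - x0 i"]) auto
  then have "ennreal (sqrt (f x0)) * root_integral
      = ennreal (2 ^ n) * (ennreal (sqrt (f x0)) * (\<integral>\<^sup>+u. ennreal (sqrt (f (?r u))) \<partial>Rn n))"
    by (simp add: mult_ac)
  also have "ennreal (sqrt (f x0)) * (\<integral>\<^sup>+u. ennreal (sqrt (f (?r u))) \<partial>Rn n)
      = (\<integral>\<^sup>+u. ennreal (sqrt (f x0)) * ennreal (sqrt (f (?r u))) \<partial>Rn n)"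
    by (intro nn_integral_cmult[symmetric] measurable_compose[OF m]) measurable
  also have "\<dots> \<le> (\<integral>\<^sup>+u. ennreal (f u) \<partial>Rn n)"
  proof (rule nn_integral_mono)
    fix u assume u: "u \<in> space (Rn n)"
    have "cmb n (1/2) (?r u) x0 = u"
      by (rule space_Rn_eqI) (use u in \<open>auto simp: field_simps\<close>)
    then have "sqrt (f (?r u)) * sqrt (f x0) \<le> f u"
      using density_cmb[of "?r u" x0 "1/2"] x0 by (auto simp: powr_half_sqrt density_nonneg)
    then show "ennreal (sqrt (f x0)) * ennreal (sqrt (f (?r u))) \<le> ennreal (f u)"
      using x0 by (simp add: ennreal_mult'[symmetric] density_nonneg mult.commute ennreal_leI)
  qed
  also have "\<dots> = 1" by (rule nn_integral_density_1)
  finally show ?thesis by (simp add: mult_left_mono)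
qed

lemma ex_density_pos: "\<exists>x\<in>space (Rn n). 0 < f x"
proof (rule ccontr)
  assume "\<not> ?thesis"
  then have "(\<integral>\<^sup>+x. ennreal (f x) \<partial>Rn n) = (\<integral>\<^sup>+x. 0 \<partial>Rn n)"
    by (intro nn_integral_cong) (auto simp: ennreal_neg not_less)
  then show False by (simp add: nn_integral_density_1)
qed

lemma root_integral_finite: "root_integral < \<infinity>"
proof (rule ccontr)
  assume "\<not> ?thesis"
  then have [simp]: "root_integral = \<infinity>" by (simp add: less_top[symmetric])
  obtain x where "x \<in> space (Rn n)" "0 < f x" using ex_density_pos by blast
  then show False using sqrt_density_times_root_integral[of x]
    by (simp add: ennreal_mult_top less_top[symmetric] ennreal_mult_eq_top_iff top_unique)
qed

lemma root_integral_pos: "0 < root_integral"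
proof (rule ccontr)
  assume "\<not> ?thesis"
  then have "AE x in Rn n. ennreal (sqrt (f x)) = 0"
    unfolding root_integral_def by (subst (asm) zero_less_iff_neq_zero, simp add: nn_integral_0_iff_AE)
  then have "AE x in Rn n. ennreal (f x) = 0"
    by eventually_elim (auto simp: ennreal_eq_0_iff)
  then have "(\<integral>\<^sup>+x. ennreal (f x) \<partial>Rn n) = 0" by (simp add: nn_integral_0_iff_AE)
  then show False by (simp add: nn_integral_density_1)
qed

definition J :: real where "J = enn2real root_integral"

lemma J_eq: "ennreal J = root_integral"
  using root_integral_finite by (simp add: J_def less_top[symmetric])

lemma J_pos: "0 < J"
  unfolding J_def using root_integral_finite root_integral_pos by (simp add: enn2real_positive_iff)

text \<open>The square of the midpoint estimate. Besides bounding
  \<open>(sup f) * J\<^sup>2\<close>, it makes the density bounded, so that the \<open>Sup\<close>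
  in \<open>iso_const\<close> is a genuine supremum.\<close>

lemma density_le: "x \<in> space (Rn n) \<Longrightarrow> f x \<le> 4 ^ n / J\<^sup>2"
proof -
  assume x: "x \<in> space (Rn n)"
  have "ennreal (sqrt (f x) * J) \<le> ennreal (2 ^ n)"
    using sqrt_density_times_root_integral[OF x] J_pos density_nonneg[OF x]
    by (simp add: J_eq[symmetric] ennreal_mult')
  then have "sqrt (f x) * J \<le> 2 ^ n" by simp
  then have "(sqrt (f x) * J)\<^sup>2 \<le> (2 ^ n)\<^sup>2"
    using J_pos density_nonneg[OF x] by (intro power_mono) auto
  then have "f x * J\<^sup>2 \<le> 4 ^ n"
    using density_nonneg[OF x] by (simp add: power_mult_distrib power2_eq_square[of "2 ^ n"])
      (simp flip: power_mult_distrib)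
  then show ?thesis using J_pos by (simp add: field_simps)
qed

lemma density_bounded: "bdd_above (f ` space (Rn n))"
  using density_le by (auto intro!: bdd_aboveI)

end

section \<open>The density of the average of two independent copies\<close>

definition refl_at :: "nat \<Rightarrow> (nat \<Rightarrow> real) \<Rightarrow> (nat \<Rightarrow> real) \<Rightarrow> nat \<Rightarrow> real" where
  "refl_at n z y = restrict (\<lambda>i. - y i + 2 * z i) {..<n}"

lemma refl_at_in_space_Rn [simp, intro]: "refl_at n z y \<in> space (Rn n)"
  by (simp add: refl_at_def)

lemma cmb_refl_at: "z \<in> space (Rn n) \<Longrightarrow> cmb n (1/2) y (refl_at n z y) = z"
  by (rule space_Rn_eqI) (auto simp: refl_at_def field_simps)

lemma refl_at_cmb: "refl_at n (cmb n l z z') (cmb n l y y') = cmb n l (refl_at n z y) (refl_at n z' y')"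
  by (rule space_Rn_eqI) (auto simp: refl_at_def field_simps)

lemma measurable_refl_at [measurable]:
  assumes "X \<in> N \<rightarrow>\<^sub>M Rn n" "Y \<in> N \<rightarrow>\<^sub>M Rn n"
  shows "(\<lambda>w. refl_at n (X w) (Y w)) \<in> N \<rightarrow>\<^sub>M Rn n"
  unfolding refl_at_def
  by (intro measurable_into_Rn borel_measurable_add borel_measurable_times borel_measurable_uminus borel_measurable_const
      measurable_compose[OF assms(1) measurable_Rn_component] measurable_compose[OF assms(2) measurable_Rn_component])

lemma measurable_cmb [measurable]:
  assumes "X \<in> N \<rightarrow>\<^sub>M Rn n" "Y \<in> N \<rightarrow>\<^sub>M Rn n"
  shows "(\<lambda>w. cmb n l (X w) (Y w)) \<in> N \<rightarrow>\<^sub>M Rn n"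
  unfolding cmb_def
  by (intro measurable_into_Rn borel_measurable_add borel_measurable_times borel_measurable_const
      measurable_compose[OF assms(1) measurable_Rn_component] measurable_compose[OF assms(2) measurable_Rn_component])

context logconcave_prob
begin

definition avg :: "(nat \<Rightarrow> real) measure" where
  "avg = distr (\<mu> \<Otimes>\<^sub>M \<mu>) (Rn n) (\<lambda>(x, y). cmb n (1/2) x y)"

text \<open>The convolution formula: given the average \<open>z\<close> and one copy
  \<open>y\<close>, the other copy is the reflection of \<open>y\<close> in \<open>z\<close>, with
  Jacobian \<open>2 ^ n\<close>. Values are extended until finiteness is known.\<close>

definition avg_nn :: "(nat \<Rightarrow> real) \<Rightarrow> ennreal" where
  "avg_nn z = (\<integral>\<^sup>+y. ennreal (2 ^ n * (f y * f (refl_at n z y))) \<partial>Rn n)"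

lemma avg_nn_measurable [measurable]: "avg_nn \<in> borel_measurable (Rn n)"
proof -
  have "(\<lambda>(z, y). ennreal (2 ^ n * (f y * f (refl_at n z y)))) \<in> borel_measurable (Rn n \<Otimes>\<^sub>M Rn n)"
    by measurable
  then show ?thesis
    unfolding avg_nn_def[abs_def]
    by (rule sigma_finite_measure.borel_measurable_nn_integral[OF sigma_finite_Rn])
qed

text \<open>Bounding one factor by \<open>density_le\<close> leaves the integral of the other, which
  is 1. Finiteness is obtained at every point, not just almost everywhere, because log-concavity of
  a density is required pointwise.\<close>

lemma avg_nn_finite: "z \<in> space (Rn n) \<Longrightarrow> avg_nn z < \<infinity>"
proof -
  assume z: "z \<in> space (Rn n)"
  have "avg_nn z \<le> (\<integral>\<^sup>+y. ennreal (2 ^ n * (4 ^ n / J\<^sup>2)) * ennreal (f y) \<partial>Rn n)"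
    unfolding avg_nn_def
  proof (rule nn_integral_mono)
    fix y assume y: "y \<in> space (Rn n)"
    have "2 ^ n * (f y * f (refl_at n z y)) \<le> 2 ^ n * (f y * (4 ^ n / J\<^sup>2))"
      using y by (intro mult_left_mono density_le density_nonneg) auto
    then show "ennreal (2 ^ n * (f y * f (refl_at n z y))) \<le> ennreal (2 ^ n * (4 ^ n / J\<^sup>2)) * ennreal (f y)"
      using density_nonneg[OF y] by (simp add: ennreal_mult''[symmetric] ennreal_leI mult_ac)
  qed
  also have "\<dots> = ennreal (2 ^ n * (4 ^ n / J\<^sup>2))"
    by (subst nn_integral_cmult) (auto simp: nn_integral_density_1)
  finally show ?thesis by (simp add: order_le_less_trans)
qed

definition avg_density :: "(nat \<Rightarrow> real) \<Rightarrow> real" where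
  "avg_density z = enn2real (avg_nn z)"

lemma avg_density_eq: "z \<in> space (Rn n) \<Longrightarrow> ennreal (avg_density z) = avg_nn z"
  using avg_nn_finite[of z] by (simp add: avg_density_def less_top[symmetric])

text \<open>The integrand is log-concave jointly in \<open>z\<close> and \<open>y\<close>, since
  reflection commutes with convex combinations (\<open>refl_at_cmb\<close>); Prekopa-Leindler in
  \<open>y\<close> shows that its marginal is log-concave.\<close>

lemma avg_density_cmb:
  assumes z: "z \<in> space (Rn n)" "z' \<in> space (Rn n)" and l: "0 < l" "l < 1"
  shows "avg_density z powr l * avg_density z' powr (1 - l) \<le> avg_density (cmb n l z z')"
proof (rule geo_le_ennrealD[OF l])
  show "geo_le l (ennreal (avg_density z)) (ennreal (avg_density z')) (ennreal (avg_density (cmb n l z z')))"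
    unfolding avg_density_eq[OF z(1)] avg_density_eq[OF z(2)] avg_density_eq[OF cmb_in_space_Rn] avg_nn_def
  proof (rule prekopa_leindler[OF _ _ _ l])
    fix y y' assume y: "y \<in> space (Rn n)" "y' \<in> space (Rn n)"
    let ?r = "refl_at n z y" and ?r' = "refl_at n z' y'"
    note nn = density_nonneg[OF y(1)] density_nonneg[OF y(2)] density_nonneg[OF refl_at_in_space_Rn]
    have "(2 ^ n * (f y * f ?r)) powr l * (2 ^ n * (f y' * f ?r')) powr (1 - l)
        = ((2 ^ n) powr l * (2 ^ n) powr (1 - l)) * ((f y powr l * f y' powr (1 - l)) * (f ?r powr l * f ?r' powr (1 - l)))"
      using nn by (simp add: powr_mult)
    also have "(2 ^ n) powr l * (2 ^ n) powr (1 - l) = (2 ^ n :: real)"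
      by (simp add: powr_add[symmetric])
    also have "2 ^ n * ((f y powr l * f y' powr (1 - l)) * (f ?r powr l * f ?r' powr (1 - l)))
        \<le> 2 ^ n * (f (cmb n l y y') * f (cmb n l ?r ?r'))"
      using y l by (intro mult_left_mono mult_mono density_cmb density_nonneg) auto
    finally show "geo_le l (ennreal (2 ^ n * (f y * f ?r))) (ennreal (2 ^ n * (f y' * f ?r')))
        (ennreal (2 ^ n * (f (cmb n l y y') * f (refl_at n (cmb n l z z') (cmb n l y y')))))"
      unfolding refl_at_cmb by (intro geo_le_ennrealI l)
  qed (use z in measurable)
qed (simp_all add: avg_density_def)

lemma prob_space_avg: "prob_space avg"
proof -
  interpret P: pair_prob_space \<mu> \<mu> ..
  show ?thesis unfolding avg_def by (rule P.prob_space_distr) measurable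
qed

text \<open>Change of variable from the second copy to the average, with the first copy fixed,
  followed by Fubini.\<close>

lemma nn_integral_avg:
  assumes [measurable]: "h \<in> borel_measurable (Rn n)"
  shows "(\<integral>\<^sup>+z. h z \<partial>avg) = (\<integral>\<^sup>+z. avg_nn z * h z \<partial>Rn n)"
proof -
  interpret R: sigma_finite_measure "Rn n" by (rule sigma_finite_Rn)
  interpret RR: pair_sigma_finite "Rn n" "Rn n" ..
  have "(\<integral>\<^sup>+z. h z \<partial>avg) = (\<integral>\<^sup>+x. \<integral>\<^sup>+y. h (cmb n (1/2) x y) \<partial>\<mu> \<partial>\<mu>)"
    unfolding avg_def by (subst nn_integral_distr) (auto simp: nn_integral_fst[symmetric] case_prod_beta)
  also have "\<dots> = (\<integral>\<^sup>+x. ennreal (f x) * (\<integral>\<^sup>+y. h (cmb n (1/2) x y) \<partial>\<mu>) \<partial>Rn n)"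
    by (rule nn_integral_eq) measurable
  also have "\<dots> = (\<integral>\<^sup>+x. (\<integral>\<^sup>+z. ennreal (2 ^ n * (f x * f (refl_at n z x))) * h z \<partial>Rn n) \<partial>Rn n)"
  proof (rule nn_integral_cong)
    fix x assume x: "x \<in> space (Rn n)"
    have [measurable]: "(\<lambda>z. refl_at n z x) \<in> Rn n \<rightarrow>\<^sub>M Rn n" "(\<lambda>y. cmb n (1/2) x y) \<in> Rn n \<rightarrow>\<^sub>M Rn n"
      using x by measurable
    have "(\<integral>\<^sup>+y. h (cmb n (1/2) x y) \<partial>\<mu>) = (\<integral>\<^sup>+y. ennreal (f y) * h (cmb n (1/2) x y) \<partial>Rn n)"
      by (rule nn_integral_eq) measurable
    also have "\<dots> = ennreal (2 ^ n) * (\<integral>\<^sup>+z. ennreal (f (refl_at n z x)) * h (cmb n (1/2) x (refl_at n z x)) \<partial>Rn n)"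
      by (subst nn_integral_Rn_affine[of _ _ 2 "\<lambda>i. - x i"]) (auto simp: refl_at_def)
    also have "\<dots> = ennreal (2 ^ n) * (\<integral>\<^sup>+z. ennreal (f (refl_at n z x)) * h z \<partial>Rn n)"
      by (intro arg_cong2[where f="(*)"] refl nn_integral_cong) (simp add: cmb_refl_at)
    finally have "ennreal (f x) * (\<integral>\<^sup>+y. h (cmb n (1/2) x y) \<partial>\<mu>)
        = (ennreal (f x) * ennreal (2 ^ n)) * (\<integral>\<^sup>+z. ennreal (f (refl_at n z x)) * h z \<partial>Rn n)"
      by (simp add: mult_ac)
    also have "\<dots> = (\<integral>\<^sup>+z. (ennreal (f x) * ennreal (2 ^ n)) * (ennreal (f (refl_at n z x)) * h z) \<partial>Rn n)"
      by (rule nn_integral_cmult[symmetric]) measurable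
    also have "\<dots> = (\<integral>\<^sup>+z. ennreal (2 ^ n * (f x * f (refl_at n z x))) * h z \<partial>Rn n)"
      using density_nonneg[OF x] density_nonneg[OF refl_at_in_space_Rn]
      by (intro nn_integral_cong) (simp add: ennreal_mult mult_ac)
    finally show "ennreal (f x) * (\<integral>\<^sup>+y. h (cmb n (1/2) x y) \<partial>\<mu>)
        = (\<integral>\<^sup>+z. ennreal (2 ^ n * (f x * f (refl_at n z x))) * h z \<partial>Rn n)" .
  qed
  also have "\<dots> = (\<integral>\<^sup>+z. (\<integral>\<^sup>+x. ennreal (2 ^ n * (f x * f (refl_at n z x))) * h z \<partial>Rn n) \<partial>Rn n)"
    by (rule RR.Fubini') measurable
  also have "\<dots> = (\<integral>\<^sup>+z. avg_nn z * h z \<partial>Rn n)"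
    unfolding avg_nn_def by (intro nn_integral_cong nn_integral_multc) measurable
  finally show ?thesis .
qed

lemma avg_eq_density: "avg = density (Rn n) (\<lambda>z. ennreal (avg_density z))"
proof (rule measure_eqI)
  show "sets avg = sets (density (Rn n) (\<lambda>z. ennreal (avg_density z)))" by (simp add: avg_def)
  fix A assume "A \<in> sets avg"
  then have [measurable]: "A \<in> sets (Rn n)" by (simp add: avg_def)
  have "emeasure avg A = (\<integral>\<^sup>+z. indicator A z \<partial>avg)" by (simp add: avg_def)
  also have "\<dots> = (\<integral>\<^sup>+z. avg_nn z * indicator A z \<partial>Rn n)" by (rule nn_integral_avg) measurable
  also have "\<dots> = (\<integral>\<^sup>+z. ennreal (avg_density z) * indicator A z \<partial>Rn n)"
    by (intro nn_integral_cong) (simp add: avg_density_eq)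
  also have "\<dots> = emeasure (density (Rn n) (\<lambda>z. ennreal (avg_density z))) A"
    unfolding avg_density_def by (rule emeasure_density[symmetric]) measurable
  finally show "emeasure avg A = emeasure (density (Rn n) (\<lambda>z. ennreal (avg_density z))) A" .
qed

lemma logconcave_prob_avg: "logconcave_prob avg n avg_density"
proof -
  interpret A: prob_space avg by (rule prob_space_avg)
  show ?thesis
  proof
    show "logconcave_density n avg avg_density"
      unfolding logconcave_density_def using avg_eq_density avg_density_cmb
      by (auto simp: avg_density_def[abs_def])
  qed
qed

end

section \<open>Averaging two independent copies\<close>

lemma ip_measurable [measurable]: "(\<lambda>x. ip n a x) \<in> borel_measurable (Rn n)"
  unfolding ip_def by (intro borel_measurable_sum borel_measurable_times borel_measurable_const measurable_Rn_component) simp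

lemma ip_cmb: "ip n a (cmb n l x y) = l * ip n a x + (1 - l) * ip n a y"
  by (simp add: ip_def sum_distrib_left sum.distrib[symmetric] algebra_simps)

lemma halfspaces_measurable: "H \<in> halfspaces n \<Longrightarrow> H \<in> sets (Rn n)"
  by (auto simp: halfspaces_def)

lemma abs_mult_le_sum_squares: "\<bar>a * b\<bar> \<le> a\<^sup>2 + b\<^sup>2" for a b :: real
proof -
  have "2 * \<bar>a * b\<bar> \<le> a\<^sup>2 + b\<^sup>2"
    using sum_squares_bound[of "\<bar>a\<bar>" "\<bar>b\<bar>"] by (simp add: abs_mult)
  then show ?thesis using abs_ge_zero[of "a * b"] by linarith
qed

text \<open>For such \<open>Y\<close>, the value at the average of two copies is the average of two
  independent copies of \<open>Y\<close>. This is all that tracking second moments through the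
  averaging requires.\<close>

definition mid_affine :: "nat \<Rightarrow> ((nat \<Rightarrow> real) \<Rightarrow> real) \<Rightarrow> bool" where
  "mid_affine n Y \<longleftrightarrow> Y \<in> borel_measurable (Rn n) \<and>
     (\<forall>x\<in>space (Rn n). \<forall>y\<in>space (Rn n). Y (cmb n (1/2) x y) = (Y x + Y y) / 2)"

context logconcave_prob
begin

lemma measure_halfspace_avg:
  assumes H: "H \<in> halfspaces n"
  shows "(measure \<mu> H)\<^sup>2 \<le> measure avg H"
proof -
  interpret P: pair_prob_space \<mu> \<mu> ..
  have [measurable]: "H \<in> sets (Rn n)" by (rule halfspaces_measurable[OF H])
  then have [measurable]: "H \<in> sets \<mu>" by (simp add: sets_eq)
  obtain a b where Hab: "H = {x \<in> space (Rn n). ip n a x \<le> b}" using H by (auto simp: halfspaces_def)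
  have sub: "H \<times> H \<subseteq> (\<lambda>(x, y). cmb n (1/2) x y) -` H \<inter> space (\<mu> \<Otimes>\<^sub>M \<mu>)"
    by (auto simp: Hab ip_cmb space_pair_measure space_eq)
  have "(measure \<mu> H)\<^sup>2 = measure (\<mu> \<Otimes>\<^sub>M \<mu>) (H \<times> H)"
    by (simp add: measure_def emeasure_pair_measure_Times enn2real_mult power2_eq_square)
  also have "\<dots> \<le> measure (\<mu> \<Otimes>\<^sub>M \<mu>) ((\<lambda>(x, y). cmb n (1/2) x y) -` H \<inter> space (\<mu> \<Otimes>\<^sub>M \<mu>))"
    by (rule P.finite_measure_mono[OF sub]) measurable
  also have "\<dots> = measure avg H"
    unfolding avg_def by (rule measure_distr[symmetric]) measurable
  finally show ?thesis .
qed

text \<open>Expanding the square of \<open>(Y x + Y y) / 2\<close> leaves two quarters of the second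
  moment; by independence and centring the mixed term integrates to 0.\<close>

lemma mid_affine_avg:
  assumes Y: "mid_affine n Y" and int: "integrable \<mu> (\<lambda>x. (Y x)\<^sup>2)" and mean: "(\<integral>x. Y x \<partial>\<mu>) = 0"
  shows "integrable avg (\<lambda>x. (Y x)\<^sup>2)" "(\<integral>x. Y x \<partial>avg) = 0"
    "(\<integral>x. (Y x)\<^sup>2 \<partial>avg) = (\<integral>x. (Y x)\<^sup>2 \<partial>\<mu>) / 2"
proof -
  interpret P: pair_prob_space \<mu> \<mu> ..
  have [measurable]: "Y \<in> borel_measurable (Rn n)" using Y by (simp add: mid_affine_def)
  have mid: "Y (cmb n (1/2) (fst p) (snd p)) = (Y (fst p) + Y (snd p)) / 2" if "p \<in> space (\<mu> \<Otimes>\<^sub>M \<mu>)" for p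
    using Y that by (auto simp: mid_affine_def space_pair_measure space_eq)
  have intY: "integrable \<mu> Y" by (rule square_integrable_imp_integrable[OF _ int]) measurable
  have fst: "integrable (\<mu> \<Otimes>\<^sub>M \<mu>) (\<lambda>p. h (fst p))" "(\<integral>p. h (fst p) \<partial>(\<mu> \<Otimes>\<^sub>M \<mu>)) = (\<integral>x. h x \<partial>\<mu>)"
    if "integrable \<mu> h" for h :: "_ \<Rightarrow> real"
  proof -
    have m: "h \<in> borel_measurable \<mu>" using that by simp
    show "integrable (\<mu> \<Otimes>\<^sub>M \<mu>) (\<lambda>p. h (fst p))"
      using integrable_distr_eq[of fst "\<mu> \<Otimes>\<^sub>M \<mu>" \<mu> h] m that by (simp add: distr_pair_fst)
    show "(\<integral>p. h (fst p) \<partial>(\<mu> \<Otimes>\<^sub>M \<mu>)) = (\<integral>x. h x \<partial>\<mu>)"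
      using integral_distr[of fst "\<mu> \<Otimes>\<^sub>M \<mu>" \<mu> h] m by (simp add: distr_pair_fst)
  qed
  have snd: "integrable (\<mu> \<Otimes>\<^sub>M \<mu>) (\<lambda>p. h (snd p))" "(\<integral>p. h (snd p) \<partial>(\<mu> \<Otimes>\<^sub>M \<mu>)) = (\<integral>x. h x \<partial>\<mu>)"
    if "integrable \<mu> h" for h :: "_ \<Rightarrow> real"
  proof -
    have m: "h \<in> borel_measurable \<mu>" using that by simp
    have d: "distr (\<mu> \<Otimes>\<^sub>M \<mu>) \<mu> snd = \<mu>"
      by (subst P.distr_pair_swap, subst distr_distr) (auto simp: comp_def case_prod_beta distr_pair_fst)
    show "integrable (\<mu> \<Otimes>\<^sub>M \<mu>) (\<lambda>p. h (snd p))"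
      using integrable_distr_eq[of snd "\<mu> \<Otimes>\<^sub>M \<mu>" \<mu> h] m that by (simp add: d)
    show "(\<integral>p. h (snd p) \<partial>(\<mu> \<Otimes>\<^sub>M \<mu>)) = (\<integral>x. h x \<partial>\<mu>)"
      using integral_distr[of snd "\<mu> \<Otimes>\<^sub>M \<mu>" \<mu> h] m by (simp add: d)
  qed
  have prod: "integrable (\<mu> \<Otimes>\<^sub>M \<mu>) (\<lambda>p. Y (fst p) * Y (snd p))"
  proof (rule Bochner_Integration.integrable_bound)
    show "integrable (\<mu> \<Otimes>\<^sub>M \<mu>) (\<lambda>p. (Y (fst p))\<^sup>2 + (Y (snd p))\<^sup>2)"
      by (intro Bochner_Integration.integrable_add fst snd int)
    show "AE p in \<mu> \<Otimes>\<^sub>M \<mu>. norm (Y (fst p) * Y (snd p)) \<le> norm ((Y (fst p))\<^sup>2 + (Y (snd p))\<^sup>2)"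
      by (simp add: abs_mult_le_sum_squares)
  qed measurable
  have prod0: "(\<integral>p. Y (fst p) * Y (snd p) \<partial>(\<mu> \<Otimes>\<^sub>M \<mu>)) = 0"
    using P.integral_fst'[OF prod] by (simp add: mean)
  have mm: "(\<lambda>(x, y). cmb n (1/2) x y) \<in> \<mu> \<Otimes>\<^sub>M \<mu> \<rightarrow>\<^sub>M Rn n" by measurable
  have sq: "((Y (fst p) + Y (snd p)) / 2)\<^sup>2 = (1/4) * (Y (fst p))\<^sup>2 + (1/4) * (Y (snd p))\<^sup>2 + (1/2) * (Y (fst p) * Y (snd p))" for p
    by (simp add: power2_eq_square field_simps)
  have i2: "integrable (\<mu> \<Otimes>\<^sub>M \<mu>) (\<lambda>p. (1/4) * (Y (fst p))\<^sup>2 + (1/4) * (Y (snd p))\<^sup>2 + (1/2) * (Y (fst p) * Y (snd p)))"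
    by (intro Bochner_Integration.integrable_add integrable_mult_right fst snd int prod)
  have "integrable avg (\<lambda>x. (Y x)\<^sup>2) \<longleftrightarrow> integrable (\<mu> \<Otimes>\<^sub>M \<mu>) (\<lambda>p. (Y (cmb n (1/2) (fst p) (snd p)))\<^sup>2)"
    unfolding avg_def by (subst integrable_distr_eq[OF mm]) (auto simp: case_prod_beta)
  also have "\<dots> \<longleftrightarrow> integrable (\<mu> \<Otimes>\<^sub>M \<mu>) (\<lambda>p. (1/4) * (Y (fst p))\<^sup>2 + (1/4) * (Y (snd p))\<^sup>2 + (1/2) * (Y (fst p) * Y (snd p)))"
    by (rule Bochner_Integration.integrable_cong[OF refl]) (simp only: mid sq)
  finally show "integrable avg (\<lambda>x. (Y x)\<^sup>2)" using i2 by simp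
  have "(\<integral>x. (Y x)\<^sup>2 \<partial>avg) = (\<integral>p. (Y (cmb n (1/2) (fst p) (snd p)))\<^sup>2 \<partial>(\<mu> \<Otimes>\<^sub>M \<mu>))"
    unfolding avg_def by (subst integral_distr[OF mm]) (auto simp: case_prod_beta)
  also have "\<dots> = (\<integral>p. (1/4) * (Y (fst p))\<^sup>2 + (1/4) * (Y (snd p))\<^sup>2 + (1/2) * (Y (fst p) * Y (snd p)) \<partial>(\<mu> \<Otimes>\<^sub>M \<mu>))"
    by (rule Bochner_Integration.integral_cong[OF refl]) (simp only: mid sq)
  also have "\<dots> = (1/4) * (\<integral>p. (Y (fst p))\<^sup>2 \<partial>(\<mu> \<Otimes>\<^sub>M \<mu>)) + (1/4) * (\<integral>p. (Y (snd p))\<^sup>2 \<partial>(\<mu> \<Otimes>\<^sub>M \<mu>))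
      + (1/2) * (\<integral>p. Y (fst p) * Y (snd p) \<partial>(\<mu> \<Otimes>\<^sub>M \<mu>))"
    using fst(1)[OF int] snd(1)[OF int] prod by simp
  finally show "(\<integral>x. (Y x)\<^sup>2 \<partial>avg) = (\<integral>x. (Y x)\<^sup>2 \<partial>\<mu>) / 2"
    by (simp add: fst(2)[OF int] snd(2)[OF int] prod0)
  have "(\<integral>x. Y x \<partial>avg) = (\<integral>p. Y (cmb n (1/2) (fst p) (snd p)) \<partial>(\<mu> \<Otimes>\<^sub>M \<mu>))"
    unfolding avg_def by (subst integral_distr[OF mm]) (auto simp: case_prod_beta)
  also have "\<dots> = (\<integral>p. (Y (fst p) + Y (snd p)) / 2 \<partial>(\<mu> \<Otimes>\<^sub>M \<mu>))"
    by (rule Bochner_Integration.integral_cong[OF refl]) (simp only: mid)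
  also have "\<dots> = 0"
    using fst[OF intY] snd[OF intY] by (simp add: mean)
  finally show "(\<integral>x. Y x \<partial>avg) = 0" .
qed

end

text \<open>Integrability and zero mean are part of the invariant because the next halving of the
  second moment needs them.\<close>

lemma ex_iterated_avg:
  assumes "logconcave_prob \<mu> n f"
  shows "\<exists>\<nu> g. logconcave_prob \<nu> n g \<and> (\<forall>H\<in>halfspaces n. measure \<mu> H ^ (2 ^ k) \<le> measure \<nu> H) \<and>
    (\<forall>Y. mid_affine n Y \<longrightarrow> integrable \<mu> (\<lambda>x. (Y x)\<^sup>2) \<longrightarrow> (\<integral>x. Y x \<partial>\<mu>) = 0 \<longrightarrow>
      integrable \<nu> (\<lambda>x. (Y x)\<^sup>2) \<and> (\<integral>x. Y x \<partial>\<nu>) = 0 \<and> (\<integral>x. (Y x)\<^sup>2 \<partial>\<nu>) = (\<integral>x. (Y x)\<^sup>2 \<partial>\<mu>) / 2 ^ k)"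
proof (induction k)
  case 0
  show ?case using assms by (intro exI[of _ \<mu>] exI[of _ f]) auto
next
  case (Suc k)
  then obtain \<nu> g where \<nu>: "logconcave_prob \<nu> n g" and H: "\<And>H. H \<in> halfspaces n \<Longrightarrow> measure \<mu> H ^ (2 ^ k) \<le> measure \<nu> H"
    and Y: "\<And>Y. mid_affine n Y \<Longrightarrow> integrable \<mu> (\<lambda>x. (Y x)\<^sup>2) \<Longrightarrow> (\<integral>x. Y x \<partial>\<mu>) = 0 \<Longrightarrow>
      integrable \<nu> (\<lambda>x. (Y x)\<^sup>2) \<and> (\<integral>x. Y x \<partial>\<nu>) = 0 \<and> (\<integral>x. (Y x)\<^sup>2 \<partial>\<nu>) = (\<integral>x. (Y x)\<^sup>2 \<partial>\<mu>) / 2 ^ k"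
    by blast
  interpret N: logconcave_prob \<nu> n g by fact
  show ?case
  proof (intro exI conjI ballI allI impI)
    show "logconcave_prob N.avg n N.avg_density" by (rule N.logconcave_prob_avg)
  next
    fix A assume A: "A \<in> halfspaces n"
    have "measure \<mu> A ^ 2 ^ Suc k = (measure \<mu> A ^ 2 ^ k)\<^sup>2" by (simp add: power_mult[symmetric] mult.commute)
    also have "\<dots> \<le> (measure \<nu> A)\<^sup>2" using H[OF A] by (intro power_mono) auto
    also have "\<dots> \<le> measure N.avg A" by (rule N.measure_halfspace_avg[OF A])
    finally show "measure \<mu> A ^ 2 ^ Suc k \<le> measure N.avg A" .
  next
    fix Z assume Z: "mid_affine n Z" "integrable \<mu> (\<lambda>x. (Z x)\<^sup>2)" "(\<integral>x. Z x \<partial>\<mu>) = 0"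
    note Y' = Y[OF Z] and av = N.mid_affine_avg[OF Z(1), of]
    show "integrable N.avg (\<lambda>x. (Z x)\<^sup>2)" "(\<integral>x. Z x \<partial>N.avg) = 0"
      "(\<integral>x. (Z x)\<^sup>2 \<partial>N.avg) = (\<integral>x. (Z x)\<^sup>2 \<partial>\<mu>) / 2 ^ Suc k"
      using av Y' by auto
  qed
qed

section \<open>Finiteness of second moments\<close>

text \<open>The midpoint inequality makes the ratio of consecutive values along an arithmetic
  progression nonincreasing. Hence a single halving, which the limit 0 provides, repeats at every
  further step.\<close>

lemma logconcave_tail_geometric:
  fixes p :: "real \<Rightarrow> real"
  assumes p: "\<And>r. 0 \<le> p r" "\<And>r. p r \<le> 1" and anti: "\<And>r s. r \<le> s \<Longrightarrow> p s \<le> p r"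
    and mid: "\<And>r s. p r * p s \<le> (p ((r + s) / 2))\<^sup>2" and lim: "(p \<longlongrightarrow> 0) at_top"
  shows "\<exists>d>0. \<forall>k::nat. p (real k * d) \<le> (1/2) ^ k"
proof -
  have "\<exists>d>0. p d \<le> p 0 / 2"
  proof (cases "p 0 = 0")
    case True
    then show ?thesis using anti[of 0 1] by (intro exI[of _ 1]) auto
  next
    case False
    then have "0 < p 0 / 2" using p(1)[of 0] by simp
    then have "\<forall>\<^sub>F r in at_top. p r < p 0 / 2" by (rule order_tendstoD[OF lim])
    then have "\<forall>\<^sub>F r in at_top. p r < p 0 / 2 \<and> 0 < r" by (intro eventually_conj eventually_gt_at_top)
    then show ?thesis by (auto simp: eventually_at_top_linorder intro: less_imp_le)
  qed
  then obtain d where d: "d > 0" "p d \<le> p 0 / 2" by blast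
  have ratio: "p (real (Suc k) * d) \<le> p (real k * d) / 2" for k
  proof (induction k)
    case 0
    then show ?case using d by simp
  next
    case (Suc k)
    let ?a = "p (real k * d)" and ?b = "p (real (Suc k) * d)" and ?c = "p (real (Suc (Suc k)) * d)"
    have "(real k * d + real (Suc (Suc k)) * d) / 2 = real (Suc k) * d" by (simp add: field_simps)
    then have ac: "?a * ?c \<le> ?b\<^sup>2" using mid[of "real k * d" "real (Suc (Suc k)) * d"] by simp
    show ?case
    proof (cases "?b = 0")
      case True
      then show ?thesis using anti[of "real (Suc k) * d" "real (Suc (Suc k)) * d"] d by auto
    next
      case False
      then have b: "?b > 0" using p(1)[of "real (Suc k) * d"] by linarith
      then have "2 * ?b * ?c \<le> ?a * ?c" using Suc.IH p(1) by (intro mult_right_mono) auto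
      also note ac
      finally have "?b * (2 * ?c) \<le> ?b * ?b" by (simp add: power2_eq_square mult_ac)
      then show ?thesis using b by (simp only: mult_le_cancel_left_pos)
    qed
  qed
  have "p (real k * d) \<le> (1/2) ^ k" for k
  proof (induction k)
    case 0
    then show ?case using p(2)[of 0] by simp
  next
    case (Suc k)
    then show ?case using ratio[of k] by simp
  qed
  with d show ?thesis by blast
qed

text \<open>A discrete layer-cake bound: the first \<open>j\<close> odd numbers sum to the square of
  \<open>j\<close>, and \<open>y\<close> is rounded up to the next multiple of
  \<open>d\<close>.\<close>

lemma square_le_level_sum:
  fixes y d :: real
  assumes d: "d > 0" and y: "y \<ge> 0"
  shows "ennreal (y\<^sup>2) \<le> (\<Sum>k. ennreal (d\<^sup>2 * (2 * real k + 1)) * indicator {real k * d..} y)"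
proof -
  define m where "m = nat \<lfloor>y / d\<rfloor>"
  have m: "real m \<le> y / d" "y / d < real m + 1" using d y by (auto simp: m_def of_nat_nat)
  have md: "real m * d \<le> y" "y < (real m + 1) * d" using m d by (auto simp: field_simps)
  have "y\<^sup>2 \<le> ((real m + 1) * d)\<^sup>2" using md y by (intro power_mono) auto
  also have "\<dots> = (\<Sum>k<Suc m. d\<^sup>2 * (2 * real k + 1))"
  proof -
    have "(\<Sum>k<j. 2 * real k + 1) = (real j)\<^sup>2" for j
      by (induction j) (auto simp: power2_eq_square algebra_simps)
    then show ?thesis by (simp add: sum_distrib_left[symmetric] power_mult_distrib mult.commute del: sum.lessThan_Suc)
  qed
  finally have "ennreal (y\<^sup>2) \<le> (\<Sum>k<Suc m. ennreal (d\<^sup>2 * (2 * real k + 1)))"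
    by (subst sum_ennreal) (auto intro: ennreal_leI)
  also have "\<dots> = (\<Sum>k<Suc m. ennreal (d\<^sup>2 * (2 * real k + 1)) * indicator {real k * d..} y)"
  proof (rule sum.cong[OF refl])
    fix k assume "k \<in> {..<Suc m}"
    then have "real k * d \<le> real m * d" using d by (intro mult_right_mono) auto
    then have "real k * d \<le> y" using md by linarith
    then show "ennreal (d\<^sup>2 * (2 * real k + 1)) = ennreal (d\<^sup>2 * (2 * real k + 1)) * indicator {real k * d..} y" by simp
  qed
  also have "\<dots> \<le> (\<Sum>k. ennreal (d\<^sup>2 * (2 * real k + 1)) * indicator {real k * d..} y)"
    by (rule sum_le_suminf) auto
  finally show ?thesis .
qed

context logconcave_prob
begin

text \<open>Prekopa-Leindler applied to the density cut off to the two tails: a midpoint of points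
  from the tails lies in the tail at the middle threshold. The factor \<open>s\<close> allows for
  both signs of the coordinate.\<close>

lemma tail_midpoint:
  assumes i: "i < n"
  shows "measure \<mu> {x \<in> space (Rn n). r \<le> s * x i} * measure \<mu> {x \<in> space (Rn n). r' \<le> s * x i}
    \<le> (measure \<mu> {x \<in> space (Rn n). (r + r') / 2 \<le> s * x i})\<^sup>2"
proof -
  let ?T = "\<lambda>r. {x \<in> space (Rn n). r \<le> s * x i}"
  have [measurable]: "?T r \<in> sets (Rn n)" for r using i by measurable
  have em: "ennreal (measure \<mu> (?T r)) = (\<integral>\<^sup>+x. ennreal (f x * indicator (?T r) x) \<partial>Rn n)" for r
  proof -
    have "ennreal (measure \<mu> (?T r)) = (\<integral>\<^sup>+x. indicator (?T r) x \<partial>\<mu>)"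
      by (simp add: emeasure_eq_measure[symmetric] sets_eq)
    also have "\<dots> = (\<integral>\<^sup>+x. ennreal (f x) * indicator (?T r) x \<partial>Rn n)" by (rule nn_integral_eq) measurable
    also have "\<dots> = (\<integral>\<^sup>+x. ennreal (f x * indicator (?T r) x) \<partial>Rn n)"
      by (intro nn_integral_cong) (auto simp: indicator_def)
    finally show ?thesis .
  qed
  have "measure \<mu> (?T r) powr (1/2) * measure \<mu> (?T r') powr (1 - 1/2) \<le> measure \<mu> (?T ((r + r') / 2))"
  proof (rule geo_le_ennrealD)
    show "geo_le (1/2) (ennreal (measure \<mu> (?T r))) (ennreal (measure \<mu> (?T r'))) (ennreal (measure \<mu> (?T ((r + r') / 2))))"
      unfolding em
    proof (rule prekopa_leindler)
      fix x y assume xy: "x \<in> space (Rn n)" "y \<in> space (Rn n)"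
      show "geo_le (1/2) (ennreal (f x * indicator (?T r) x)) (ennreal (f y * indicator (?T r') y))
          (ennreal (f (cmb n (1/2) x y) * indicator (?T ((r + r') / 2)) (cmb n (1/2) x y)))"
      proof (rule geo_le_ennrealI)
        show "(f x * indicator (?T r) x) powr (1/2) * (f y * indicator (?T r') y) powr (1 - 1/2)
          \<le> f (cmb n (1/2) x y) * indicator (?T ((r + r') / 2)) (cmb n (1/2) x y)"
        proof (cases "x \<in> ?T r \<and> y \<in> ?T r'")
          case True
          then have "cmb n (1/2) x y \<in> ?T ((r + r') / 2)" using i by (auto simp: field_simps)
          then show ?thesis using True density_cmb[OF xy, of "1/2"] by simp
        qed (use density_nonneg[OF cmb_in_space_Rn] in auto)
      qed auto
    qed (simp_all only: zero_less_divide_1_iff, measurable)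
  qed auto
  then have "sqrt (measure \<mu> (?T r)) * sqrt (measure \<mu> (?T r')) \<le> measure \<mu> (?T ((r + r') / 2))"
    by (simp add: powr_half_sqrt)
  then have "(sqrt (measure \<mu> (?T r)) * sqrt (measure \<mu> (?T r')))\<^sup>2 \<le> (measure \<mu> (?T ((r + r') / 2)))\<^sup>2"
    by (intro power_mono) auto
  then show ?thesis by (simp add: power_mult_distrib)
qed

lemma tail_second_moment:
  assumes i: "i < n"
  shows "(\<integral>\<^sup>+x. ennreal ((max 0 (s * x i))\<^sup>2) \<partial>\<mu>) < \<infinity>"
proof -
  let ?T = "\<lambda>r. {x \<in> space (Rn n). r \<le> s * x i}"
  have [measurable]: "?T r \<in> sets (Rn n)" for r using i by measurable
  then have Tm: "?T r \<in> sets \<mu>" for r by (simp add: sets_eq)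
  have [measurable]: "(\<lambda>x. s * x i) \<in> borel_measurable \<mu>" using i by measurable
  have "\<exists>d>0. \<forall>k::nat. measure \<mu> (?T (real k * d)) \<le> (1/2) ^ k"
  proof (rule logconcave_tail_geometric)
    show "measure \<mu> (?T b) \<le> measure \<mu> (?T a)" if "a \<le> b" for a b
      using that by (intro finite_measure_mono Tm) auto
    show "measure \<mu> (?T a) * measure \<mu> (?T b) \<le> (measure \<mu> (?T ((a + b) / 2)))\<^sup>2" for a b
      by (rule tail_midpoint[OF i])
    show "((\<lambda>r. measure \<mu> (?T r)) \<longlongrightarrow> 0) at_top"
    proof -
      interpret D: real_distribution "distr \<mu> borel (\<lambda>x. s * x i)" by (rule real_distribution_distr) simp
      have lim: "((\<lambda>r. 1 - cdf (distr \<mu> borel (\<lambda>x. s * x i)) (r - 1)) \<longlongrightarrow> 1 - 1) at_top"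
      proof (intro tendsto_intros)
        have "filterlim (\<lambda>r::real. r - 1) at_top at_top"
          using filterlim_tendsto_add_at_top[OF tendsto_const[of "-1"] filterlim_ident[of "at_top :: real filter"]] by simp
        then show "((\<lambda>r. cdf (distr \<mu> borel (\<lambda>x. s * x i)) (r - 1)) \<longlongrightarrow> 1) at_top"
          by (rule filterlim_compose[OF D.cdf_lim_at_top_prob])
      qed
      \<comment> \<open>The tail is closed at \<open>r\<close> and the distribution function
        includes its endpoint, so the shift to \<open>r - 1\<close> keeps the two events
        disjoint.\<close>
      have bound: "measure \<mu> (?T r) \<le> 1 - cdf (distr \<mu> borel (\<lambda>x. s * x i)) (r - 1)" for r
      proof -
        have "cdf (distr \<mu> borel (\<lambda>x. s * x i)) (r - 1) = measure \<mu> {x \<in> space \<mu>. s * x i \<le> r - 1}"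
          by (simp add: cdf_def measure_distr vimage_def Int_def conj_commute)
        moreover have "measure \<mu> (?T r) + measure \<mu> {x \<in> space \<mu>. s * x i \<le> r - 1}
            = measure \<mu> (?T r \<union> {x \<in> space \<mu>. s * x i \<le> r - 1})"
          by (rule finite_measure_Union[symmetric]) (auto intro: Tm)
        ultimately show ?thesis using prob_le_1[of "?T r \<union> {x \<in> space \<mu>. s * x i \<le> r - 1}"] by linarith
      qed
      show ?thesis
      proof (rule tendsto_sandwich[OF _ _ tendsto_const])
        show "((\<lambda>r. 1 - cdf (distr \<mu> borel (\<lambda>x. s * x i)) (r - 1)) \<longlongrightarrow> 0) at_top" using lim by simp
        show "\<forall>\<^sub>F r in at_top. measure \<mu> (?T r) \<le> 1 - cdf (distr \<mu> borel (\<lambda>x. s * x i)) (r - 1)"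
          by (intro always_eventually allI bound)
      qed simp
    qed
  qed auto
  then obtain d where d: "d > 0" and pd: "\<And>k::nat. measure \<mu> (?T (real k * d)) \<le> (1/2) ^ k" by blast
  have "(\<integral>\<^sup>+x. ennreal ((max 0 (s * x i))\<^sup>2) \<partial>\<mu>)
      \<le> (\<integral>\<^sup>+x. (\<Sum>k. ennreal (d\<^sup>2 * (2 * real k + 1)) * indicator {real k * d..} (max 0 (s * x i))) \<partial>\<mu>)"
    by (intro nn_integral_mono square_le_level_sum d) simp
  also have "\<dots> = (\<Sum>k. (\<integral>\<^sup>+x. ennreal (d\<^sup>2 * (2 * real k + 1)) * indicator {real k * d..} (max 0 (s * x i)) \<partial>\<mu>))"
    by (rule nn_integral_suminf) measurable
  also have "\<dots> \<le> (\<Sum>k. ennreal (d\<^sup>2 * (2 * real k + 1) * (1/2) ^ k))"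
  proof (intro suminf_le allI)
    fix k
    have "(\<integral>\<^sup>+x. ennreal (d\<^sup>2 * (2 * real k + 1)) * indicator {real k * d..} (max 0 (s * x i)) \<partial>\<mu>)
        = ennreal (d\<^sup>2 * (2 * real k + 1)) * (\<integral>\<^sup>+x. indicator {real k * d..} (max 0 (s * x i)) \<partial>\<mu>)"
      by (rule nn_integral_cmult) measurable
    also have "\<dots> \<le> ennreal (d\<^sup>2 * (2 * real k + 1)) * ennreal ((1/2) ^ k)"
    proof (rule mult_left_mono)
      show "(\<integral>\<^sup>+x. indicator {real k * d..} (max 0 (s * x i)) \<partial>\<mu>) \<le> ennreal ((1/2) ^ k)"
      proof (cases "k = 0")
        \<comment> \<open>At level 0 the indicator of the truncated coordinate is 1 everywhere, so
          it does not describe the tail at 0; the total mass 1 suffices here.\<close>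
        case True
        have "(\<integral>\<^sup>+x. indicator {real k * d..} (max 0 (s * x i)) \<partial>\<mu>) \<le> (\<integral>\<^sup>+x. 1 \<partial>\<mu>)"
          by (intro nn_integral_mono) (auto simp: indicator_def)
        then show ?thesis using True by (simp add: emeasure_space_1)
      next
        case False
        then have "0 < real k * d" using d by simp
        then have "(\<integral>\<^sup>+x. indicator {real k * d..} (max 0 (s * x i)) \<partial>\<mu>) = (\<integral>\<^sup>+x. indicator (?T (real k * d)) x \<partial>\<mu>)"
          by (intro nn_integral_cong) (auto simp: indicator_def space_eq)
        also have "\<dots> = ennreal (measure \<mu> (?T (real k * d)))" by (simp add: Tm emeasure_eq_measure)
        finally show ?thesis using ennreal_leI[OF pd[of k]] by simp
      qed
    qed simp
    finally show "(\<integral>\<^sup>+x. ennreal (d\<^sup>2 * (2 * real k + 1)) * indicator {real k * d..} (max 0 (s * x i)) \<partial>\<mu>)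
        \<le> ennreal (d\<^sup>2 * (2 * real k + 1) * (1/2) ^ k)"
      by (subst ennreal_mult) auto
  qed auto
  also have "\<dots> < \<infinity>"
  proof -
    have "summable (\<lambda>k. real (Suc k) * (1/2) ^ k)"
      by (rule sums_summable[OF geometric_deriv_sums]) simp
    moreover have "summable (\<lambda>k. (1/2) ^ k :: real)" by (simp add: summable_geometric)
    \<comment> \<open>Writing \<open>2 * k + 1\<close> as \<open>2 * (k + 1) - 1\<close> reduces the
      series to the geometric series and its derivative.\<close>
    ultimately have "summable (\<lambda>k. (2 * d\<^sup>2) * (real (Suc k) * (1/2) ^ k) - d\<^sup>2 * (1/2) ^ k)"
      by (intro summable_diff summable_mult)
    also have "(\<lambda>k. (2 * d\<^sup>2) * (real (Suc k) * (1/2) ^ k) - d\<^sup>2 * (1/2) ^ k) = (\<lambda>k. d\<^sup>2 * (2 * real k + 1) * (1/2) ^ k)"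
    proof
      fix k
      have "(2 * d\<^sup>2) * (real (Suc k) * t) - d\<^sup>2 * t = d\<^sup>2 * (2 * real k + 1) * t" for t :: real
        by (simp add: algebra_simps)
      then show "(2 * d\<^sup>2) * (real (Suc k) * (1/2) ^ k) - d\<^sup>2 * (1/2) ^ k = d\<^sup>2 * (2 * real k + 1) * (1/2) ^ k" .
    qed
    finally have "(\<Sum>k. ennreal (d\<^sup>2 * (2 * real k + 1) * (1/2) ^ k)) \<noteq> \<infinity>"
      unfolding infinity_ennreal_def by (rule ennreal_suminf_neq_top) auto
    then show ?thesis unfolding infinity_ennreal_def by (simp only: less_top)
  qed
  finally show ?thesis .
qed

text \<open>Bochner integrals of non-integrable functions are 0 by convention, so the entries of
  \<open>cov_matrix\<close> carry information only once this is known.\<close>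

lemma square_integrable_coordinate:
  assumes i: "i < n"
  shows "integrable \<mu> (\<lambda>x. (x i)\<^sup>2)"
proof (rule integrableI_nonneg)
  show m: "(\<lambda>x. (x i)\<^sup>2) \<in> borel_measurable \<mu>" using i by measurable
  have [measurable]: "(\<lambda>x. x i) \<in> borel_measurable \<mu>" using i by measurable
  have "(\<integral>\<^sup>+x. ennreal ((x i)\<^sup>2) \<partial>\<mu>)
      \<le> (\<integral>\<^sup>+x. ennreal ((max 0 (1 * x i))\<^sup>2) + ennreal ((max 0 (- 1 * x i))\<^sup>2) \<partial>\<mu>)"
    by (intro nn_integral_mono) (auto simp: max_def ennreal_plus[symmetric] simp del: ennreal_plus)
  also have "\<dots> = (\<integral>\<^sup>+x. ennreal ((max 0 (1 * x i))\<^sup>2) \<partial>\<mu>) + (\<integral>\<^sup>+x. ennreal ((max 0 (- 1 * x i))\<^sup>2) \<partial>\<mu>)"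
    by (rule nn_integral_add) measurable
  also have "\<dots> < \<infinity>" using tail_second_moment[OF i] by (simp only: ennreal_add_less_top infinity_ennreal_def)
  finally show "(\<integral>\<^sup>+x. ennreal ((x i)\<^sup>2) \<partial>\<mu>) < \<infinity>" .
qed auto

end

section \<open>Half-spaces below a point of a log-concave density\<close>

lemma ip_Suc: "ip (Suc n) a y = ip n a y + a n * y n"
  by (simp add: ip_def)

lemma ip_upd: "ip n (a(n := c)) y = ip n a y"
  unfolding ip_def by (rule sum.cong) auto

lemma ip_single: "j < n \<Longrightarrow> ip n (\<lambda>i. if i = j then c else 0) y = c * y j"
  by (simp add: ip_def if_distrib[of "\<lambda>t. t * _"] cong: if_cong)

lemma ip_congI: "(\<And>i. i < n \<Longrightarrow> w i = l * y i + m * z i) \<Longrightarrow> ip n a w = l * ip n a y + m * ip n a z"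
  by (simp add: ip_def sum_distrib_left sum.distrib[symmetric] algebra_simps)

text \<open>Separation of the origin from a convex set with no topological assumption, by induction
  on the dimension: a functional for the slice where the last coordinate vanishes is extended by one
  coefficient. Points matter only through their first \<open>n\<close> coordinates, so that the
  slice can be treated in one dimension less.\<close>

lemma weak_separation:
  fixes C :: "(nat \<Rightarrow> real) set"
  assumes "\<And>y z l. y \<in> C \<Longrightarrow> z \<in> C \<Longrightarrow> 0 < l \<Longrightarrow> l < 1 \<Longrightarrow> \<exists>w\<in>C. \<forall>i<n. w i = l * y i + (1 - l) * z i"
    and "C \<noteq> {}" and "\<And>y. y \<in> C \<Longrightarrow> \<exists>i<n. y i \<noteq> 0"
  shows "\<exists>a. (\<exists>i<n. a i \<noteq> 0) \<and> (\<forall>y\<in>C. 0 \<le> ip n a y)"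
  using assms
proof (induction n arbitrary: C)
  case 0
  then show ?case by auto
next
  case (Suc n)
  note conv = Suc.prems(1) and ne = Suc.prems(2) and nz = Suc.prems(3)
  consider "\<forall>y\<in>C. 0 \<le> y n" | "\<forall>y\<in>C. y n \<le> 0" | "\<exists>y\<in>C. y n > 0" "\<exists>z\<in>C. z n < 0"
    by (meson not_le)
  then show ?case
  proof cases
    case 1
    then show ?thesis by (intro exI[of _ "\<lambda>i. if i = n then 1 else 0"]) (auto simp: ip_single)
  next
    case 2
    then show ?thesis by (intro exI[of _ "\<lambda>i. if i = n then -1 else 0"]) (auto simp: ip_single)
  next
    case 3
    \<comment> \<open>The segment between points on opposite sides meets the slice; the weights are
      those that cancel the last coordinate.\<close>
    have cross: "\<exists>w\<in>C. w n = 0 \<and> (\<forall>i<n. w i = (- z n) / (y n - z n) * y i + y n / (y n - z n) * z i)"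
      if yz: "y \<in> C" "z \<in> C" "y n > 0" "z n < 0" for y z
    proof -
      let ?l = "(- z n) / (y n - z n)"
      have l: "0 < ?l" "?l < 1" using yz by (auto simp: field_simps)
      have l1: "1 - ?l = y n / (y n - z n)" using yz by (simp add: field_simps)
      obtain w where w: "w \<in> C" "\<forall>i<Suc n. w i = ?l * y i + (1 - ?l) * z i" using conv[OF yz(1,2) l] by blast
      have "w n = ?l * y n + (1 - ?l) * z n" using w by simp
      also have "\<dots> = 0" unfolding l1 using yz by (simp add: field_simps)
      finally have "w n = 0" .
      then show ?thesis using w unfolding l1 by (intro bexI[of _ w]) auto
    qed
    define C0 where "C0 = {y \<in> C. y n = 0}"
    have "\<exists>a. (\<exists>i<n. a i \<noteq> 0) \<and> (\<forall>y\<in>C0. 0 \<le> ip n a y)"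
    proof (rule Suc.IH)
      fix y z :: "nat \<Rightarrow> real" and l :: real assume "y \<in> C0" "z \<in> C0" "0 < l" "l < 1"
      then show "\<exists>w\<in>C0. \<forall>i<n. w i = l * y i + (1 - l) * z i"
        using conv[of y z l] by (auto simp: C0_def less_Suc_eq)
    next
      show "C0 \<noteq> {}" using cross 3 by (fastforce simp: C0_def)
    next
      fix y assume "y \<in> C0"
      then show "\<exists>i<n. y i \<noteq> 0" using nz[of y] by (auto simp: C0_def less_Suc_eq)
    qed
    then obtain a where a: "\<exists>i<n. a i \<noteq> 0" "\<And>y. y \<in> C0 \<Longrightarrow> 0 \<le> ip n a y" by blast
    \<comment> \<open>Points with positive last coordinate bound the new coefficient from below,
      those with negative one from above. \<open>LU\<close> shows that the bounds are compatible, by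
      evaluating \<open>a\<close> at the crossing point; hence \<open>Sup L\<close> works.\<close>
    define L where "L = {- ip n a y / y n | y. y \<in> C \<and> y n > 0}"
    have LU: "- ip n a y / y n \<le> ip n a z / (- z n)" if yz: "y \<in> C" "z \<in> C" "y n > 0" "z n < 0" for y z
    proof -
      obtain w where w: "w \<in> C" "w n = 0" "\<forall>i<n. w i = (- z n) / (y n - z n) * y i + y n / (y n - z n) * z i"
        using cross[OF yz] by blast
      have "0 \<le> ip n a w" using w by (intro a(2)) (simp add: C0_def)
      also have "ip n a w = (- z n) / (y n - z n) * ip n a y + y n / (y n - z n) * ip n a z"
        by (rule ip_congI) (use w in auto)
      also have "\<dots> = ((- z n) * ip n a y + y n * ip n a z) / (y n - z n)"
        by (simp add: add_divide_distrib diff_divide_distrib)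
      finally have "0 \<le> (- z n) * ip n a y + y n * ip n a z"
        using yz by (simp add: zero_le_divide_iff)
      then show ?thesis using yz by (simp add: field_simps)
    qed
    obtain y0 z0 where y0: "y0 \<in> C" "y0 n > 0" and z0: "z0 \<in> C" "z0 n < 0" using 3 by blast
    have Lne: "L \<noteq> {}" using y0 by (auto simp: L_def)
    have Lbd: "bdd_above L" using LU[OF _ z0(1) _ z0(2)] by (intro bdd_aboveI[of _ "ip n a z0 / (- z0 n)"]) (auto simp only: L_def mem_Collect_eq)
    define c where "c = Sup L"
    have "0 \<le> ip n a y + c * y n" if y: "y \<in> C" for y
    proof -
      consider "y n > 0" | "y n < 0" | "y n = 0" by linarith
      then show ?thesis
      proof cases
        case 1
        then have "- ip n a y / y n \<le> c" unfolding c_def using y Lbd by (intro cSup_upper) (auto simp: L_def)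
        then show ?thesis using 1 by (simp add: field_simps)
      next
        case 2
        have "c \<le> ip n a y / (- y n)"
          unfolding c_def by (rule cSup_least[OF Lne]) (use LU y 2 in \<open>auto simp: L_def\<close>)
        then show ?thesis using 2 by (simp add: field_simps)
      next
        case 3
        then show ?thesis using a(2)[of y] y by (simp add: C0_def)
      qed
    qed
    moreover have "ip (Suc n) (a(n := c)) y = ip n a y + c * y n" for y
      by (simp only: ip_Suc ip_upd fun_upd_same)
    moreover obtain i where "i < n" "a i \<noteq> 0" using a(1) by blast
    then have "i < Suc n" "(a(n := c)) i \<noteq> 0" by auto
    ultimately show ?thesis by metis
  qed
qed

text \<open>Integrating first over a coordinate with nonzero coefficient, each fibre contains at
  most one point.\<close>

lemma hyperplane_null:
  assumes j: "j < n" "a j \<noteq> 0"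
  shows "emeasure (Rn n) {x \<in> space (Rn n). ip n a x = b} = 0"
proof -
  let ?P = "{x \<in> space (Rn n). ip n a x = b}"
  have ins: "{..<n} = insert j ({..<n} - {j})" using j by auto
  have m: "?P \<in> sets (Rn n)" by measurable
  have "emeasure (Rn n) ?P = (\<integral>\<^sup>+x. indicator ?P x \<partial>Rn n)" using m by simp
  also have "\<dots> = (\<integral>\<^sup>+x. (\<integral>\<^sup>+y. indicator ?P (x(j := y)) \<partial>lborel) \<partial>(\<Pi>\<^sub>M i\<in>{..<n} - {j}. lborel))"
  proof -
    have "Rn n = (\<Pi>\<^sub>M i\<in>insert j ({..<n} - {j}). lborel)" unfolding Rn_def using ins by simp
    moreover have "(\<lambda>x. indicator ?P x :: ennreal) \<in> borel_measurable (Rn n)" using m by measurable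
    ultimately show ?thesis
      using lborel_product.product_nn_integral_insert[of "{..<n} - {j}" j "\<lambda>x. indicator ?P x"] by simp
  qed
  also have "\<dots> \<le> (\<integral>\<^sup>+x. 0 \<partial>(\<Pi>\<^sub>M i\<in>{..<n} - {j}. (lborel :: real measure)))"
  proof (rule nn_integral_mono)
    fix x :: "nat \<Rightarrow> real"
    let ?s = "\<Sum>i\<in>{..<n} - {j}. a i * x i"
    have ip: "ip n a (x(j := y)) = a j * y + ?s" for y
      unfolding ip_def by (subst sum.remove[of _ j]) (use j in auto)
    have "(\<integral>\<^sup>+y. indicator ?P (x(j := y)) \<partial>lborel) \<le> (\<integral>\<^sup>+y. indicator {(b - ?s) / a j} y \<partial>lborel)"
      using j by (intro nn_integral_mono) (auto simp: indicator_def ip field_simps)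
    then show "(\<integral>\<^sup>+y. indicator ?P (x(j := y)) \<partial>lborel) \<le> 0" by simp
  qed
  finally show ?thesis by simp
qed

context logconcave_prob
begin

text \<open>Convexity of the superlevel set \<open>{f > f x}\<close> yields a half-space at \<open>x\<close> on which \<open>f \<le> f x\<close>
  almost everywhere, whence \<open>f \<le> sqrt (f x) * sqrt f\<close> there.\<close>

lemma ex_halfspace_measure_le:
  assumes n: "0 < n" and x: "x \<in> space (Rn n)"
  shows "\<exists>H\<in>halfspaces n. x \<in> H \<and> measure \<mu> H \<le> sqrt (f x) * J"
proof -
  have "\<exists>a. (\<exists>i<n. a i \<noteq> 0) \<and> (\<forall>y\<in>space (Rn n). f x < f y \<longrightarrow> ip n a x \<le> ip n a y)"
  proof (cases "\<exists>y\<in>space (Rn n). f x < f y")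
    case False
    \<comment> \<open>Here \<open>f x\<close> is the maximum, so any nonzero normal vector will do;
      one exists because \<open>n\<close> is positive.\<close>
    then show ?thesis using n by (intro exI[of _ "\<lambda>_. 1"]) auto
  next
    case True
    define C where "C = {\<lambda>i. y i - x i | y. y \<in> space (Rn n) \<and> f x < f y}"
    have "\<exists>a. (\<exists>i<n. a i \<noteq> 0) \<and> (\<forall>y\<in>C. 0 \<le> ip n a y)"
    proof (rule weak_separation)
      fix p q :: "nat \<Rightarrow> real" and l :: real assume pq: "p \<in> C" "q \<in> C" and l: "0 < l" "l < 1"
      obtain y z where p: "p = (\<lambda>i. y i - x i)" "y \<in> space (Rn n)" "f x < f y"
        and q: "q = (\<lambda>i. z i - x i)" "z \<in> space (Rn n)" "f x < f z"
        using pq by (auto simp: C_def)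
      let ?m = "min (f y) (f z)"
      have m: "0 \<le> ?m" using density_nonneg p q by auto
      have "f x < ?m" using p q by simp
      also have "?m = ?m powr l * ?m powr (1 - l)" using m l by (cases "?m = 0") (auto simp: powr_add[symmetric])
      also have "\<dots> \<le> f y powr l * f z powr (1 - l)" using m l by (intro mult_mono powr_mono2) auto
      also have "\<dots> \<le> f (cmb n l y z)" by (rule density_cmb[OF p(2) q(2) l])
      finally have "(\<lambda>i. cmb n l y z i - x i) \<in> C" unfolding C_def by blast
      then show "\<exists>w\<in>C. \<forall>i<n. w i = l * p i + (1 - l) * q i"
        by (rule bexI[rotated]) (auto simp: p q algebra_simps)
    next
      show "C \<noteq> {}" using True by (auto simp: C_def)
    next
      fix p assume "p \<in> C"
      then obtain y where p: "p = (\<lambda>i. y i - x i)" "y \<in> space (Rn n)" "f x < f y" by (auto simp: C_def)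
      show "\<exists>i<n. p i \<noteq> 0"
        using space_Rn_eqI[OF p(2) x] p by auto
    qed
    then obtain a where a: "\<exists>i<n. a i \<noteq> 0" "\<And>y. y \<in> C \<Longrightarrow> 0 \<le> ip n a y" by blast
    have "ip n a x \<le> ip n a y" if "y \<in> space (Rn n)" "f x < f y" for y
    proof -
      have "0 \<le> ip n a (\<lambda>i. y i - x i)" using that by (intro a(2)) (auto simp: C_def)
      also have "\<dots> = 1 * ip n a y + (-1) * ip n a x" by (rule ip_congI) simp
      finally show ?thesis by simp
    qed
    with a show ?thesis by blast
  qed
  then obtain a j where j: "j < n" "a j \<noteq> 0" and a: "\<And>y. y \<in> space (Rn n) \<Longrightarrow> f x < f y \<Longrightarrow> ip n a x \<le> ip n a y"
    by blast
  define H where "H = {y \<in> space (Rn n). ip n a y \<le> ip n a x}"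
  have HH: "H \<in> halfspaces n" using j by (auto simp: H_def halfspaces_def)
  have [measurable]: "H \<in> sets (Rn n)" by (rule halfspaces_measurable[OF HH])
  have "{y \<in> space (Rn n). ip n a y = ip n a x} \<in> null_sets (Rn n)"
    using hyperplane_null[of j n a, OF j] by (auto simp: null_sets_def)
  then have ae: "AE y in Rn n. y \<notin> {y \<in> space (Rn n). ip n a y = ip n a x}" by (rule AE_not_in)
  have "ennreal (measure \<mu> H) = (\<integral>\<^sup>+y. indicator H y \<partial>\<mu>)"
    by (simp add: emeasure_eq_measure[symmetric] sets_eq)
  also have "\<dots> = (\<integral>\<^sup>+y. ennreal (f y) * indicator H y \<partial>Rn n)" by (rule nn_integral_eq) measurable
  also have "\<dots> \<le> (\<integral>\<^sup>+y. ennreal (sqrt (f x)) * ennreal (sqrt (f y)) \<partial>Rn n)"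
  proof (rule nn_integral_mono_AE)
    show "AE y in Rn n. ennreal (f y) * indicator H y \<le> ennreal (sqrt (f x)) * ennreal (sqrt (f y))"
      using ae
    proof (eventually_elim, goal_cases)
      case (1 y)
      show ?case
      proof (cases "y \<in> H")
        case True
        then have y: "y \<in> space (Rn n)" "f y \<le> f x" using 1 a[of y] by (auto simp: H_def not_less intro: leI)
        have "f y = sqrt (f y) * sqrt (f y)" using density_nonneg[OF y(1)] by simp
        also have "\<dots> \<le> sqrt (f x) * sqrt (f y)" using y density_nonneg[OF y(1)] by (intro mult_right_mono) auto
        finally show ?thesis using True density_nonneg[OF x] by (simp add: ennreal_mult'[symmetric] ennreal_leI)
      qed simp
    qed
  qed
  also have "\<dots> = ennreal (sqrt (f x)) * root_integral"
    unfolding root_integral_def by (rule nn_integral_cmult) measurable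
  also have "\<dots> = ennreal (sqrt (f x) * J)"
    using density_nonneg[OF x] by (simp add: J_eq[symmetric] ennreal_mult')
  finally have "measure \<mu> H \<le> sqrt (f x) * J"
    using J_pos density_nonneg[OF x] by simp
  moreover have "x \<in> H" using x by (simp add: H_def)
  ultimately show ?thesis using HH by blast
qed

lemma tukey_depth_le: "H \<in> halfspaces n \<Longrightarrow> x \<in> H \<Longrightarrow> tukey_depth n \<mu> x \<le> measure \<mu> H"
  unfolding tukey_depth_def by (intro cInf_lower bdd_belowI[of _ 0]) auto

text \<open>In positive dimension some half-space contains \<open>x\<close>, so the
  \<open>Inf\<close> is taken over a nonempty set.\<close>

lemma tukey_depth_nonneg:
  assumes "0 < n" "x \<in> space (Rn n)"
  shows "0 \<le> tukey_depth n \<mu> x"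
  unfolding tukey_depth_def using ex_halfspace_measure_le[OF assms] by (intro cInf_greatest) auto

lemma tukey_depth_le_1:
  assumes "0 < n" "x \<in> space (Rn n)"
  shows "tukey_depth n \<mu> x \<le> 1"
  using ex_halfspace_measure_le[OF assms] tukey_depth_le prob_le_1 order_trans by blast

text \<open>The half-space chosen for \<open>\<nu>\<close> at \<open>x\<close> serves as a test
  half-space for the depth with respect to \<open>\<mu>\<close>.\<close>

lemma tukey_depth_power_le:
  assumes \<nu>: "logconcave_prob \<nu> n g" and H: "\<And>H. H \<in> halfspaces n \<Longrightarrow> measure \<mu> H ^ s \<le> measure \<nu> H"
    and n: "0 < n" and x: "x \<in> space (Rn n)"
  shows "tukey_depth n \<mu> x ^ s \<le> sqrt (g x) * logconcave_prob.J n g"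
proof -
  interpret N: logconcave_prob \<nu> n g by fact
  obtain A where A: "A \<in> halfspaces n" "x \<in> A" "measure \<nu> A \<le> sqrt (g x) * N.J"
    using N.ex_halfspace_measure_le[OF n x] by blast
  have "tukey_depth n \<mu> x ^ s \<le> measure \<mu> A ^ s"
    using A by (intro power_mono tukey_depth_le tukey_depth_nonneg n x) auto
  also have "\<dots> \<le> measure \<nu> A" by (rule H[OF A(1)])
  finally show ?thesis using A by simp
qed

end

text \<open>For exponents that are powers of two, Jensen's inequality is the nonnegativity of the
  variance, iterated.\<close>

lemma (in prob_space) expectation_power_le:
  fixes X :: "'a \<Rightarrow> real"
  assumes X: "integrable M X" and b: "\<And>x. x \<in> space M \<Longrightarrow> 0 \<le> X x" "\<And>x. x \<in> space M \<Longrightarrow> X x \<le> 1"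
  shows "expectation X ^ (2 ^ k) \<le> expectation (\<lambda>x. X x ^ (2 ^ k))"
proof (induction k)
  case (Suc k)
  have int: "integrable M (\<lambda>x. X x ^ j)" for j
    by (rule integrable_const_bound[of _ 1]) (use X b in \<open>auto simp: power_le_one\<close>)
  let ?Y = "\<lambda>x. X x ^ (2 ^ k)"
  have sq: "(?Y x)\<^sup>2 = X x ^ (2 ^ Suc k)" for x by (simp add: power_mult[symmetric] mult.commute)
  have "expectation X ^ (2 ^ Suc k) = (expectation X ^ (2 ^ k))\<^sup>2" by (simp add: power_mult[symmetric] mult.commute)
  also have "\<dots> \<le> (expectation ?Y)\<^sup>2"
    using Suc b by (intro power_mono zero_le_power integral_nonneg_AE) (auto intro: AE_I2)
  also have "\<dots> \<le> expectation (\<lambda>x. (?Y x)\<^sup>2)"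
    using variance_eq[of ?Y] variance_positive[of ?Y] int unfolding sq by simp
  finally show ?case unfolding sq .
qed simp

context logconcave_prob
begin

lemma expectation_depth_power_le:
  assumes \<nu>: "logconcave_prob \<nu> n g" and H: "\<And>H. H \<in> halfspaces n \<Longrightarrow> measure \<mu> H ^ (2 ^ k) \<le> measure \<nu> H"
    and n: "0 < n" and M: "\<And>x. x \<in> space (Rn n) \<Longrightarrow> f x \<le> M"
  shows "(\<integral>x. tukey_depth n \<mu> x \<partial>\<mu>) ^ (2 ^ k) \<le> M * (logconcave_prob.J n g)\<^sup>2"
proof -
  interpret N: logconcave_prob \<nu> n g by fact
  have M0: "0 \<le> M" using ex_density_pos M by (meson less_imp_le order_trans)
  show ?thesis
  proof (cases "integrable \<mu> (tukey_depth n \<mu>)")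
    \<comment> \<open>The integral is then 0 by convention, and the right-hand side is
      nonnegative.\<close>
    case False
    then show ?thesis using M0 by (simp add: not_integrable_integral_eq zero_power)
  next
    case True
    let ?d = "tukey_depth n \<mu>"
    have b: "0 \<le> ?d x" "?d x \<le> 1" if "x \<in> space \<mu>" for x
      using that tukey_depth_nonneg[OF n] tukey_depth_le_1[OF n] by (auto simp: space_eq)
    have int: "integrable \<mu> (\<lambda>x. ?d x ^ (2 ^ k))"
      by (rule integrable_const_bound[of _ 1]) (use True b in \<open>auto simp: power_le_one\<close>)
    have "ennreal (\<integral>x. ?d x ^ (2 ^ k) \<partial>\<mu>) = (\<integral>\<^sup>+x. ennreal (?d x ^ (2 ^ k)) \<partial>\<mu>)"
      by (rule nn_integral_eq_integral[symmetric]) (use int b in \<open>auto intro!: AE_I2\<close>)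
    also have "\<dots> \<le> (\<integral>\<^sup>+x. ennreal (sqrt (g x) * N.J) \<partial>\<mu>)"
      by (intro nn_integral_mono ennreal_leI tukey_depth_power_le[OF \<nu> H n]) (auto simp: space_eq)
    also have "\<dots> = (\<integral>\<^sup>+x. ennreal (f x) * ennreal (sqrt (g x) * N.J) \<partial>Rn n)"
      by (rule nn_integral_eq) measurable
    also have "\<dots> \<le> (\<integral>\<^sup>+x. ennreal (M * N.J) * ennreal (sqrt (g x)) \<partial>Rn n)"
    proof (rule nn_integral_mono)
      fix x assume x: "x \<in> space (Rn n)"
      have "f x * (sqrt (g x) * N.J) \<le> M * (sqrt (g x) * N.J)"
        using M[OF x] N.J_pos N.density_nonneg[OF x] by (intro mult_right_mono) auto
      then show "ennreal (f x) * ennreal (sqrt (g x) * N.J) \<le> ennreal (M * N.J) * ennreal (sqrt (g x))"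
        using M0 N.J_pos density_nonneg[OF x] by (simp add: ennreal_mult'[symmetric] ennreal_leI mult.assoc mult.commute[of "sqrt (g x)"])
    qed
    also have "\<dots> = ennreal (M * N.J) * N.root_integral"
      unfolding N.root_integral_def by (rule nn_integral_cmult) measurable
    also have "\<dots> = ennreal (M * N.J\<^sup>2)"
      using N.J_pos M0 by (simp add: N.J_eq[symmetric] ennreal_mult'[symmetric] power2_eq_square mult_ac)
    finally have "(\<integral>x. ?d x ^ (2 ^ k) \<partial>\<mu>) \<le> M * N.J\<^sup>2" using M0 by simp
    then show ?thesis using expectation_power_le[OF True b, of k] by simp
  qed
qed

end

section \<open>Gram-Schmidt coordinates and the covariance determinant\<close>

text \<open>A unit lower triangular affine change of coordinates, with Jacobian 1. It will hold the
  Gram-Schmidt residuals: row \<open>i\<close> of \<open>A\<close> predicts coordinate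
  \<open>i\<close> from the earlier ones, and \<open>b\<close> centres the result.\<close>

definition tri :: "(nat \<Rightarrow> nat \<Rightarrow> real) \<Rightarrow> (nat \<Rightarrow> real) \<Rightarrow> nat \<Rightarrow> (nat \<Rightarrow> real) \<Rightarrow> real" where
  "tri A b i x = x i - b i - (\<Sum>j<i. A i j * x j)"

lemma tri_measurable: "i < n \<Longrightarrow> tri A b i \<in> borel_measurable (Rn n)"
  unfolding tri_def[abs_def]
  by (intro borel_measurable_diff borel_measurable_sum borel_measurable_times borel_measurable_const measurable_Rn_component)
    auto

lemma tri_fun_upd: "i < n \<Longrightarrow> tri A b i (x(n := y)) = tri A b i x"
  unfolding tri_def by (auto intro!: sum.cong)

lemma tri_fun_upd_same: "tri A b n (x(n := y)) = y - (b n + (\<Sum>j<n. A n j * x j))"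
  unfolding tri_def by (simp add: algebra_simps)

lemma mid_affine_tri:
  assumes i: "i < n"
  shows "mid_affine n (tri A b i)"
  unfolding mid_affine_def
proof (intro conjI ballI)
  show "tri A b i \<in> borel_measurable (Rn n)" by (rule tri_measurable[OF i])
  fix x y :: "nat \<Rightarrow> real"
  have "(\<Sum>j<i. A i j * cmb n (1/2) x y j) = (\<Sum>j<i. (1/2) * (A i j * x j) + (1/2) * (A i j * y j))"
    using i by (intro sum.cong) (auto simp: algebra_simps)
  also have "\<dots> = (1/2) * (\<Sum>j<i. A i j * x j) + (1/2) * (\<Sum>j<i. A i j * y j)"
    by (simp only: sum.distrib sum_distrib_left)
  finally show "tri A b i (cmb n (1/2) x y) = (tri A b i x + tri A b i y) / 2"
    unfolding tri_def using i by (simp add: field_simps)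
qed

lemma nn_integral_gaussian:
  assumes d: "0 < d" and s: "0 < s"
  shows "(\<integral>\<^sup>+y. ennreal (exp (- (s * (y - p)\<^sup>2 / d))) \<partial>lborel) = ennreal (sqrt (pi * d / s))"
proof -
  define \<sigma> where "\<sigma> = sqrt (d / (2 * s))"
  have \<sigma>: "0 < \<sigma>" "2 * \<sigma>\<^sup>2 = d / s" using d s by (auto simp: \<sigma>_def)
  have eq: "exp (- (s * (y - p)\<^sup>2 / d)) = sqrt (pi * d / s) * normal_density p \<sigma> y" for y
  proof -
    have e1: "2 * pi * \<sigma>\<^sup>2 = pi * d / s" using \<sigma>(2) by (simp add: field_simps)
    have e2: "- (y - p)\<^sup>2 / (2 * \<sigma>\<^sup>2) = - (s * (y - p)\<^sup>2 / d)" unfolding \<sigma>(2) using d s by (simp add: field_simps)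
    have "sqrt (pi * d / s) \<noteq> 0" using d s by simp
    moreover have "t = c * (1 / c * t)" if "c \<noteq> 0" for t c :: real using that by simp
    ultimately show ?thesis unfolding normal_density_def e1 e2 by blast
  qed
  have "(\<integral>\<^sup>+y. ennreal (normal_density p \<sigma> y) \<partial>lborel) = ennreal 1"
    using nn_integral_eq_integral[OF integrable_normal_density[OF \<sigma>(1)], of p] integral_normal_density[OF \<sigma>(1)] by simp
  then show ?thesis unfolding eq using d s
    by (simp add: ennreal_mult nn_integral_cmult)
qed

text \<open>Only the last term depends on the last coordinate, and there it is a translated
  Gaussian. Integrating it out leaves a factor free of \<open>A\<close> and
  \<open>b\<close>.\<close>

lemma nn_integral_tri_gaussian:
  assumes s: "0 < s"
  shows "(\<And>i. i < n \<Longrightarrow> 0 < d i) \<Longrightarrow>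
    (\<integral>\<^sup>+x. ennreal (exp (- (\<Sum>i<n. s * (tri A b i x)\<^sup>2 / d i))) \<partial>Rn n) = ennreal (\<Prod>i<n. sqrt (pi * d i / s))"
proof (induction n)
  case 0
  show ?case unfolding nn_integral_Rn_0 by simp
next
  case (Suc n)
  have m: "(\<lambda>x. ennreal (exp (- (\<Sum>i<k. s * (tri A b i x)\<^sup>2 / d i)))) \<in> borel_measurable (Rn k)" for k
  proof -
    have [measurable]: "(\<lambda>x. \<Sum>i<k. s * (tri A b i x)\<^sup>2 / d i) \<in> borel_measurable (Rn k)"
      by (intro borel_measurable_sum borel_measurable_divide borel_measurable_times borel_measurable_power
          borel_measurable_const tri_measurable) simp
    show ?thesis by measurable
  qed
  have gm: "(\<lambda>y. ennreal (exp (- (s * (y - p)\<^sup>2 / e)))) \<in> borel_measurable lborel" for p e :: real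
    supply measurable_Rn_component [measurable del] by measurable
  have "(\<integral>\<^sup>+x. ennreal (exp (- (\<Sum>i<Suc n. s * (tri A b i x)\<^sup>2 / d i))) \<partial>Rn (Suc n))
      = (\<integral>\<^sup>+x. (\<integral>\<^sup>+y. ennreal (exp (- (\<Sum>i<Suc n. s * (tri A b i (x(n := y)))\<^sup>2 / d i))) \<partial>lborel) \<partial>Rn n)"
    by (rule nn_integral_Rn_Suc[OF m])
  also have "\<dots> = (\<integral>\<^sup>+x. ennreal (sqrt (pi * d n / s)) * ennreal (exp (- (\<Sum>i<n. s * (tri A b i x)\<^sup>2 / d i))) \<partial>Rn n)"
  proof (rule nn_integral_cong)
    fix x :: "nat \<Rightarrow> real"
    let ?E = "ennreal (exp (- (\<Sum>i<n. s * (tri A b i x)\<^sup>2 / d i)))" and ?p = "b n + (\<Sum>j<n. A n j * x j)"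
    have "ennreal (exp (- (\<Sum>i<Suc n. s * (tri A b i (x(n := y)))\<^sup>2 / d i)))
        = ?E * ennreal (exp (- (s * (y - ?p)\<^sup>2 / d n)))" for y
    proof -
      have "(\<Sum>i<Suc n. s * (tri A b i (x(n := y)))\<^sup>2 / d i)
          = (\<Sum>i<n. s * (tri A b i x)\<^sup>2 / d i) + s * (y - ?p)\<^sup>2 / d n"
        unfolding sum.lessThan_Suc tri_fun_upd_same
        by (intro arg_cong2[where f="(+)"] sum.cong refl) (auto simp only: tri_fun_upd lessThan_iff)
      then show ?thesis by (simp only: minus_add_distrib exp_add) (simp add: ennreal_mult)
    qed
    then have "(\<integral>\<^sup>+y. ennreal (exp (- (\<Sum>i<Suc n. s * (tri A b i (x(n := y)))\<^sup>2 / d i))) \<partial>lborel)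
        = ?E * (\<integral>\<^sup>+y. ennreal (exp (- (s * (y - ?p)\<^sup>2 / d n))) \<partial>lborel)"
      by (simp only: nn_integral_cmult[OF gm])
    also have "\<dots> = ?E * ennreal (sqrt (pi * d n / s))"
      using nn_integral_gaussian[OF Suc.prems[of n] s, of ?p] by simp
    finally show "(\<integral>\<^sup>+y. ennreal (exp (- (\<Sum>i<Suc n. s * (tri A b i (x(n := y)))\<^sup>2 / d i))) \<partial>lborel)
        = ennreal (sqrt (pi * d n / s)) * ?E" by (simp only: mult.commute)
  qed
  also have "\<dots> = ennreal (sqrt (pi * d n / s)) * (\<integral>\<^sup>+x. ennreal (exp (- (\<Sum>i<n. s * (tri A b i x)\<^sup>2 / d i))) \<partial>Rn n)"
    by (rule nn_integral_cmult[OF m])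
  also have "\<dots> = ennreal (sqrt (pi * d n / s)) * ennreal (\<Prod>i<n. sqrt (pi * d i / s))"
    using Suc by simp
  also have "\<dots> = ennreal (\<Prod>i<Suc n. sqrt (pi * d i / s))"
    using s Suc.prems by (subst ennreal_mult[symmetric]) (auto intro!: prod_nonneg simp: mult.commute less_imp_le)
  finally show ?case .
qed

text \<open>Subtracting from the last column the combination of the others that agrees with it in
  the first \<open>m\<close> rows leaves a single entry, the Schur complement.\<close>

lemma det_bordered:
  fixes S :: "nat \<Rightarrow> nat \<Rightarrow> real"
  assumes det0: "det (mat m m (\<lambda>(i, j). S i j)) \<noteq> 0"
  shows "\<exists>a. (\<forall>i<m. S i m = (\<Sum>j<m. S i j * a j)) \<and>
    det (mat (Suc m) (Suc m) (\<lambda>(i, j). S i j)) = (S m m - (\<Sum>j<m. S m j * a j)) * det (mat m m (\<lambda>(i, j). S i j))"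
proof -
  define A where "A = mat m m (\<lambda>(i, j). S i j)"
  define c where "c = vec m (\<lambda>i. S i m)"
  \<comment> \<open>Cramer's rule: the solution of the linear system through the adjugate.\<close>
  define v where "v = (1 / det A) \<cdot>\<^sub>v (adj_mat A *\<^sub>v c)"
  have A: "A \<in> carrier_mat m m" and c: "c \<in> carrier_vec m" by (auto simp: A_def c_def)
  note adj = adj_mat[OF A]
  have v: "v \<in> carrier_vec m" using adj(1) c by (simp add: v_def)
  have "A *\<^sub>v v = (1 / det A) \<cdot>\<^sub>v (A *\<^sub>v (adj_mat A *\<^sub>v c))"
    unfolding v_def using A adj(1) c by (intro mult_mat_vec[of _ m m]) auto
  also have "A *\<^sub>v (adj_mat A *\<^sub>v c) = (A * adj_mat A) *\<^sub>v c"
    using A adj(1) c by (rule assoc_mult_mat_vec[symmetric])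
  also have "\<dots> = det A \<cdot>\<^sub>v c"
    unfolding adj(2) using c by (intro eq_vecI) (auto simp: scalar_prod_def if_distrib[of "\<lambda>t. _ * t"] sum.remove)
  finally have Av: "A *\<^sub>v v = c" using det0 by (simp add: A_def[symmetric] smult_smult_assoc)
  have solve: "S i m = (\<Sum>j<m. S i j * v $ j)" if i: "i < m" for i
  proof -
    have "S i m = (A *\<^sub>v v) $ i" unfolding Av using i by (simp add: c_def)
    also have "\<dots> = (\<Sum>j<m. S i j * v $ j)"
      using i v by (auto simp: A_def scalar_prod_def lessThan_atLeast0)
    finally show ?thesis .
  qed
  define \<delta> where "\<delta> = S m m - (\<Sum>j<m. S m j * v $ j)"
  define B where "B = mat (Suc m) (Suc m) (\<lambda>(i, j). S i j)"
  \<comment> \<open>Right multiplication by this unit triangular matrix is the column operation, and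
    its determinant is 1.\<close>
  define E where "E = mat (Suc m) (Suc m) (\<lambda>(i, j). if i = j then 1 else if j = m then - v $ i else (0::real))"
  define D where "D = mat (Suc m) (Suc m) (\<lambda>(i, j). if j < m then S i j else if i < m then 0 else \<delta>)"
  have car: "B \<in> carrier_mat (Suc m) (Suc m)" "E \<in> carrier_mat (Suc m) (Suc m)" "D \<in> carrier_mat (Suc m) (Suc m)"
    by (auto simp: B_def E_def D_def)
  have "upper_triangular E" by (auto simp: E_def)
  then have detE: "det E = 1"
    using det_upper_triangular[OF _ car(2)] by (simp add: prod_list_diag_prod) (simp add: E_def)
  have "B * E = D"
  proof (rule eq_matI)
    fix i j assume "i < dim_row D" "j < dim_col D"
    then have ij: "i < Suc m" "j < Suc m" by (auto simp: D_def)
    have "(B * E) $$ (i, j) = (\<Sum>k<Suc m. S i k * (if k = j then 1 else if j = m then - v $ k else 0))"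
      using ij by (simp add: B_def E_def scalar_prod_def lessThan_atLeast0 del: sum.op_ivl_Suc)
    also have "\<dots> = D $$ (i, j)"
    proof (cases "j = m")
      case True
      have "(\<Sum>k<Suc m. S i k * (if k = j then 1 else if j = m then - v $ k else 0)) = S i m - (\<Sum>k<m. S i k * v $ k)"
      proof -
        have "(\<Sum>k<m. S i k * (if k = j then 1 else if j = m then - v $ k else 0)) = (\<Sum>k<m. - (S i k * v $ k))"
          using True by (intro sum.cong) auto
        then have "(\<Sum>k<m. S i k * (if k = j then 1 else if j = m then - v $ k else 0)) = - (\<Sum>k<m. S i k * v $ k)"
          by (simp only: sum_negf)
        then show ?thesis by (simp only: sum.lessThan_Suc) (simp add: True)
      qed
      also have "\<dots> = (if i < m then 0 else \<delta>)" using solve ij by (auto simp: \<delta>_def less_Suc_eq)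
      finally show ?thesis using True ij by (simp add: D_def)
    next
      case False
      then have "(\<Sum>k<Suc m. S i k * (if k = j then 1 else if j = m then - v $ k else 0))
          = (\<Sum>k<Suc m. if k = j then S i k else 0)" by (intro sum.cong) auto
      also have "\<dots> = S i j" using ij by (simp del: sum.lessThan_Suc)
      finally show ?thesis using False ij by (simp add: D_def)
    qed
    finally show "(B * E) $$ (i, j) = D $$ (i, j)" .
  qed (auto simp: B_def E_def D_def)
  then have "det B = det D" using det_mult[OF car(1,2)] detE by simp
  also have "det D = (\<Sum>i<Suc m. D $$ (i, m) * cofactor D i m)"
    by (rule laplace_expansion_column[OF car(3)]) simp
  also have "\<dots> = \<delta> * cofactor D m m"
    by (simp add: D_def)
  also have "cofactor D m m = det (mat_delete D m m)"
    by (simp add: cofactor_def)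
  also have "mat_delete D m m = A"
    by (rule eq_matI) (auto simp: mat_delete_def D_def A_def)
  finally show ?thesis
    using solve by (intro exI[of _ "\<lambda>j. v $ j"]) (auto simp: \<delta>_def B_def A_def)
qed

section \<open>The covariance determinant as a product of residual variances\<close>

context logconcave_prob
begin

lemma integrable_coordinate: "i < n \<Longrightarrow> integrable \<mu> (\<lambda>x. x i)"
  by (rule square_integrable_imp_integrable[OF _ square_integrable_coordinate]) measurable

lemma integrable_coordinate_mult:
  assumes "i < n" "j < n"
  shows "integrable \<mu> (\<lambda>x. x i * x j)"
proof (rule Bochner_Integration.integrable_bound)
  show "integrable \<mu> (\<lambda>x. (x i)\<^sup>2 + (x j)\<^sup>2)"
    by (intro Bochner_Integration.integrable_add square_integrable_coordinate assms)
  show "(\<lambda>x. x i * x j) \<in> borel_measurable \<mu>" using assms by measurable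
  show "AE x in \<mu>. norm (x i * x j) \<le> norm ((x i)\<^sup>2 + (x j)\<^sup>2)"
    by (simp add: abs_mult_le_sum_squares)
qed

definition cov :: "nat \<Rightarrow> nat \<Rightarrow> real" where
  "cov i j = (\<integral>x. x i * x j \<partial>\<mu>) - (\<integral>x. x i \<partial>\<mu>) * (\<integral>x. x j \<partial>\<mu>)"

definition cent :: "nat \<Rightarrow> (nat \<Rightarrow> real) \<Rightarrow> real" where
  "cent i x = x i - (\<integral>x. x i \<partial>\<mu>)"

lemma cent_integrable: "i < n \<Longrightarrow> integrable \<mu> (cent i)"
  unfolding cent_def[abs_def] by (intro Bochner_Integration.integrable_diff integrable_coordinate integrable_const)

lemma cent_mean: "i < n \<Longrightarrow> (\<integral>x. cent i x \<partial>\<mu>) = 0"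
  unfolding cent_def using integrable_coordinate prob_space by simp

lemma cent_mult:
  assumes ij: "i < n" "j < n"
  shows "integrable \<mu> (\<lambda>x. cent i x * cent j x)" "(\<integral>x. cent i x * cent j x \<partial>\<mu>) = cov i j"
proof -
  let ?e = "\<lambda>i. (\<integral>x. x i \<partial>\<mu>)"
  note int = integrable_coordinate[OF ij(1)] integrable_coordinate[OF ij(2)] integrable_coordinate_mult[OF ij]
  have eq: "cent i x * cent j x = x i * x j - ?e j * x i - ?e i * x j + ?e i * ?e j" for x
    by (simp add: cent_def algebra_simps)
  show "integrable \<mu> (\<lambda>x. cent i x * cent j x)" unfolding eq using int by simp
  show "(\<integral>x. cent i x * cent j x \<partial>\<mu>) = cov i j"
    unfolding eq using int prob_space by (simp add: cov_def algebra_simps)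
qed

lemma cov_commute: "cov i j = cov j i"
  by (simp add: cov_def mult.commute)

text \<open>Each new coordinate multiplies the determinant by a Schur complement, which is the
  second moment of the residual left after linear prediction from the earlier coordinates.
  Positivity of these factors keeps every leading minor invertible for the next step.\<close>

lemma ex_gram_schmidt_upto:
  "m \<le> n \<Longrightarrow> \<exists>A b d. (\<forall>i<m. 0 < d i \<and> integrable \<mu> (\<lambda>x. (tri A b i x)\<^sup>2) \<and> (\<integral>x. tri A b i x \<partial>\<mu>) = 0 \<and>
      (\<integral>x. (tri A b i x)\<^sup>2 \<partial>\<mu>) = d i) \<and> det (mat m m (\<lambda>(i, j). cov i j)) = (\<Prod>i<m. d i)"
proof (induction m)
  case 0
  show ?case by simp
next
  case (Suc m)
  then have mn: "m < n" by simp
  obtain A b d where IH: "\<And>i. i < m \<Longrightarrow> 0 < d i \<and> integrable \<mu> (\<lambda>x. (tri A b i x)\<^sup>2) \<and> (\<integral>x. tri A b i x \<partial>\<mu>) = 0 \<and>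
      (\<integral>x. (tri A b i x)\<^sup>2 \<partial>\<mu>) = d i" and det: "det (mat m m (\<lambda>(i, j). cov i j)) = (\<Prod>i<m. d i)"
    using Suc by auto
  have "(\<Prod>i<m. d i) > 0" using IH by (intro prod_pos) auto
  then have "det (mat m m (\<lambda>(i, j). cov i j)) \<noteq> 0" unfolding det by (rule less_imp_neq[symmetric])
  then obtain a where a: "\<And>i. i < m \<Longrightarrow> cov i m = (\<Sum>j<m. cov i j * a j)"
    and det': "det (mat (Suc m) (Suc m) (\<lambda>(i, j). cov i j))
      = (cov m m - (\<Sum>j<m. cov m j * a j)) * det (mat m m (\<lambda>(i, j). cov i j))"
    using det_bordered[of m cov] by blast
  define Y where "Y x = cent m x - (\<Sum>j<m. a j * cent j x)" for x
  define \<delta> where "\<delta> = cov m m - (\<Sum>j<m. cov m j * a j)"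
  have Yc: "integrable \<mu> (\<lambda>x. Y x * cent i x)"
    "(\<integral>x. Y x * cent i x \<partial>\<mu>) = cov m i - (\<Sum>j<m. a j * cov j i)" if i: "i < n" for i
  proof -
    have eq: "Y x * cent i x = cent m x * cent i x - (\<Sum>j<m. a j * (cent j x * cent i x))" for x
      by (simp add: Y_def left_diff_distrib sum_distrib_right mult.assoc)
    have int: "integrable \<mu> (\<lambda>x. a j * (cent j x * cent i x))" if "j < m" for j
      using that mn i by (intro integrable_mult_right cent_mult) auto
    show "integrable \<mu> (\<lambda>x. Y x * cent i x)" unfolding eq
      using mn i int by (intro Bochner_Integration.integrable_diff Bochner_Integration.integrable_sum cent_mult) auto
    show "(\<integral>x. Y x * cent i x \<partial>\<mu>) = cov m i - (\<Sum>j<m. a j * cov j i)"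
      unfolding eq using mn i int cent_mult
      by (subst Bochner_Integration.integral_diff) (auto simp: Bochner_Integration.integral_sum)
  qed
  \<comment> \<open>\<open>a\<close> solves the normal equations, so the residual is orthogonal to
    every earlier centred coordinate; this reduces its second moment to its pairing with
    \<open>cent m\<close>.\<close>
  have Y0: "(\<integral>x. Y x * cent i x \<partial>\<mu>) = 0" if i: "i < m" for i
    using Yc(2)[of i] i mn a[OF i] by (simp add: cov_commute[of _ i] mult.commute)
  have Ysq: "(Y x)\<^sup>2 = Y x * cent m x - (\<Sum>j<m. a j * (Y x * cent j x))" for x
  proof -
    have "(Y x)\<^sup>2 = Y x * (cent m x - (\<Sum>j<m. a j * cent j x))" unfolding Y_def power2_eq_square ..
    also have "\<dots> = Y x * cent m x - Y x * (\<Sum>j<m. a j * cent j x)" by (rule right_diff_distrib)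
    also have "Y x * (\<Sum>j<m. a j * cent j x) = (\<Sum>j<m. a j * (Y x * cent j x))"
      unfolding sum_distrib_left by (intro sum.cong refl mult.left_commute)
    finally show ?thesis .
  qed
  have intj: "integrable \<mu> (\<lambda>x. a j * (Y x * cent j x))" if "j < m" for j
    using that mn by (intro integrable_mult_right Yc) auto
  have Ysq_int: "integrable \<mu> (\<lambda>x. (Y x)\<^sup>2)" unfolding Ysq
    using intj mn by (intro Bochner_Integration.integrable_diff Bochner_Integration.integrable_sum Yc) auto
  have Ysq_val: "(\<integral>x. (Y x)\<^sup>2 \<partial>\<mu>) = \<delta>"
  proof -
    have "(\<integral>x. (Y x)\<^sup>2 \<partial>\<mu>) = (\<integral>x. Y x * cent m x \<partial>\<mu>) - (\<integral>x. (\<Sum>j<m. a j * (Y x * cent j x)) \<partial>\<mu>)"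
      unfolding Ysq by (intro Bochner_Integration.integral_diff Yc(1) mn Bochner_Integration.integrable_sum intj) simp
    also have "(\<integral>x. (\<Sum>j<m. a j * (Y x * cent j x)) \<partial>\<mu>) = (\<Sum>j<m. (\<integral>x. a j * (Y x * cent j x) \<partial>\<mu>))"
      by (intro Bochner_Integration.integral_sum intj) simp
    also have "\<dots> = 0" by (intro sum.neutral) (simp add: Y0)
    also have "(\<integral>x. Y x * cent m x \<partial>\<mu>) = cov m m - (\<Sum>j<m. a j * cov j m)" by (rule Yc(2)[OF mn])
    also have "(\<Sum>j<m. a j * cov j m) = (\<Sum>j<m. cov m j * a j)"
      by (intro sum.cong refl) (metis cov_commute mult.commute)
    finally show ?thesis by (simp add: \<delta>_def)
  qed
  have Ymean: "(\<integral>x. Y x \<partial>\<mu>) = 0"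
    unfolding Y_def using mn cent_integrable cent_mean
    by (subst Bochner_Integration.integral_diff) (auto simp: Bochner_Integration.integral_sum)
  define A' where "A' = A(m := a)"
  define b' where "b' = b(m := (\<integral>x. x m \<partial>\<mu>) - (\<Sum>j<m. a j * (\<integral>x. x j \<partial>\<mu>)))"
  have triY: "tri A' b' m x = Y x" for x
    by (simp add: tri_def A'_def b'_def Y_def cent_def right_diff_distrib sum_subtractf)
  have tri_old: "tri A' b' i = tri A b i" if "i < m" for i
    using that by (auto simp: tri_def A'_def b'_def fun_eq_iff)
  \<comment> \<open>Otherwise \<open>\<mu>\<close> would be carried by a hyperplane, a Lebesgue null
    set, although it has a density.\<close>
  have "\<delta> > 0"
  proof (rule ccontr)
    assume "\<not> \<delta> > 0"
    moreover have "0 \<le> \<delta>" unfolding Ysq_val[symmetric] by simp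
    ultimately have "(\<integral>x. (Y x)\<^sup>2 \<partial>\<mu>) = 0" using Ysq_val by simp
    then have "AE x in \<mu>. (Y x)\<^sup>2 = 0"
      using integral_nonneg_eq_0_iff_AE[OF Ysq_int] by simp
    then have Y0: "AE x in \<mu>. Y x = 0" by simp
    define \<alpha> where "\<alpha> = (\<lambda>i. if i = m then 1 else if i < m then - a i else 0)"
    have ip: "ip n \<alpha> x = x m - (\<Sum>j<m. a j * x j)" for x
    proof -
      have "ip n \<alpha> x = (\<Sum>i<Suc m. \<alpha> i * x i)"
        unfolding ip_def using mn by (intro sum.mono_neutral_right) (auto simp: \<alpha>_def)
      also have "\<dots> = x m + (\<Sum>i<m. - (a i * x i))"
        by (simp add: \<alpha>_def)
      finally show ?thesis by (simp add: sum_negf)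
    qed
    have Yip: "Y x = ip n \<alpha> x - b' m" for x
      unfolding ip triY[symmetric] by (simp add: tri_def A'_def)
    have "{x \<in> space (Rn n). ip n \<alpha> x = b' m} \<in> null_sets (Rn n)"
      using hyperplane_null[of m n \<alpha> "b' m"] mn by (auto simp: null_sets_def \<alpha>_def)
    then have "AE x in Rn n. x \<notin> {x \<in> space (Rn n). ip n \<alpha> x = b' m}" by (rule AE_not_in)
    then have "AE x in \<mu>. x \<notin> {x \<in> space (Rn n). ip n \<alpha> x = b' m}"
      by (subst \<mu>_eq, subst AE_density) auto
    then have "AE x in \<mu>. False"
      using Y0 AE_space by eventually_elim (auto simp: Yip space_eq)
    then show False by simp
  qed
  note pos = this
  define d' where "d' = d(m := \<delta>)"
  have "0 < d' i \<and> integrable \<mu> (\<lambda>x. (tri A' b' i x)\<^sup>2) \<and> (\<integral>x. tri A' b' i x \<partial>\<mu>) = 0 \<and>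
      (\<integral>x. (tri A' b' i x)\<^sup>2 \<partial>\<mu>) = d' i" if "i < Suc m" for i
  proof (cases "i = m")
    case True
    then show ?thesis using pos Ysq_int Ysq_val Ymean by (simp add: triY d'_def)
  next
    case False
    then have "i < m" using that by simp
    then show ?thesis using IH[of i] False by (simp add: tri_old d'_def)
  qed
  moreover have "det (mat (Suc m) (Suc m) (\<lambda>(i, j). cov i j)) = (\<Prod>i<Suc m. d' i)"
  proof -
    have "(\<Prod>i<m. d' i) = (\<Prod>i<m. d i)" by (intro prod.cong) (auto simp: d'_def)
    then show ?thesis unfolding det' det \<delta>_def[symmetric] prod.lessThan_Suc by (simp add: d'_def)
  qed
  ultimately show ?case by blast
qed

lemma ex_gram_schmidt:
  "\<exists>A b d. (\<forall>i<n. 0 < d i \<and> integrable \<mu> (\<lambda>x. (tri A b i x)\<^sup>2) \<and> (\<integral>x. tri A b i x \<partial>\<mu>) = 0 \<and>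
      (\<integral>x. (tri A b i x)\<^sup>2 \<partial>\<mu>) = d i) \<and> det (cov_matrix n \<mu>) = (\<Prod>i<n. d i)"
  using ex_gram_schmidt_upto[of n] unfolding cov_matrix_def cov_def by simp

text \<open>A density with small second moments cannot be small everywhere: compare it with the Gaussian
  \<open>exp (- Q)\<close>, where \<open>Q\<close> has mean \<open>n\<close>, and use \<open>exp (- Q) \<ge> exp (- n) * (1 + n - Q)\<close>.\<close>

lemma density_bound_lower:
  assumes s: "0 < s" and G: "\<And>x. x \<in> space (Rn n) \<Longrightarrow> f x \<le> G"
    and Y: "\<And>i. i < n \<Longrightarrow> 0 < d i \<and> integrable \<mu> (\<lambda>x. (tri A b i x)\<^sup>2) \<and> (\<integral>x. (tri A b i x)\<^sup>2 \<partial>\<mu>) = d i / s"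
  shows "exp (- real n) \<le> G * (\<Prod>i<n. sqrt (pi * d i / s))"
proof -
  define Q where "Q x = (\<Sum>i<n. s * (tri A b i x)\<^sup>2 / d i)" for x
  have G0: "0 \<le> G" using ex_density_pos G by (meson less_imp_le order_trans)
  have int: "integrable \<mu> (\<lambda>x. s * (tri A b i x)\<^sup>2 / d i)" if "i < n" for i
    using Y[OF that] by simp
  have Qint: "integrable \<mu> Q" unfolding Q_def[abs_def]
    using int by (intro Bochner_Integration.integrable_sum) auto
  have "(\<integral>x. Q x \<partial>\<mu>) = (\<Sum>i<n. (\<integral>x. s * (tri A b i x)\<^sup>2 / d i \<partial>\<mu>))"
    unfolding Q_def using int by (intro Bochner_Integration.integral_sum) auto
  also have "\<dots> = (\<Sum>i<n. 1)"
  proof (rule sum.cong[OF refl])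
    fix i assume "i \<in> {..<n}"
    then show "(\<integral>x. s * (tri A b i x)\<^sup>2 / d i \<partial>\<mu>) = 1" using Y[of i] s by simp
  qed
  finally have Qmean: "(\<integral>x. Q x \<partial>\<mu>) = real n" by simp
  have Qnn: "0 \<le> Q x" for x unfolding Q_def using Y s by (intro sum_nonneg) (auto intro!: divide_nonneg_pos)
  have Qm [measurable]: "Q \<in> borel_measurable (Rn n)"
    unfolding Q_def[abs_def]
    by (intro borel_measurable_sum borel_measurable_divide borel_measurable_times borel_measurable_power
        borel_measurable_const tri_measurable) simp
  have expint: "integrable \<mu> (\<lambda>x. exp (- Q x))"
    by (rule integrable_const_bound[of _ 1]) (use Qnn in auto)
  have "exp (- real n) = (\<integral>x. exp (- real n) * (1 + real n - Q x) \<partial>\<mu>)"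
    using Qint prob_space by (simp add: Qmean)
  also have "\<dots> \<le> (\<integral>x. exp (- Q x) \<partial>\<mu>)"
  proof (rule integral_mono)
    fix x
    have "exp (- real n) * (1 + real n - Q x) \<le> exp (- real n) * exp (real n - Q x)"
    proof (rule mult_left_mono)
      show "1 + real n - Q x \<le> exp (real n - Q x)" using exp_ge_add_one_self[of "real n - Q x"] by linarith
    qed simp
    also have "\<dots> = exp (- Q x)" by (simp add: exp_add[symmetric])
    finally show "exp (- real n) * (1 + real n - Q x) \<le> exp (- Q x)" .
  qed (use Qint expint in auto)
  finally have "ennreal (exp (- real n)) \<le> ennreal (\<integral>x. exp (- Q x) \<partial>\<mu>)" by (rule ennreal_leI)
  also have "\<dots> = (\<integral>\<^sup>+x. ennreal (exp (- Q x)) \<partial>\<mu>)"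
    by (rule nn_integral_eq_integral[symmetric, OF expint]) simp
  also have "\<dots> = (\<integral>\<^sup>+x. ennreal (f x) * ennreal (exp (- Q x)) \<partial>Rn n)"
    by (rule nn_integral_eq) measurable
  also have "\<dots> \<le> (\<integral>\<^sup>+x. ennreal G * ennreal (exp (- Q x)) \<partial>Rn n)"
    using G by (intro nn_integral_mono mult_right_mono ennreal_leI) auto
  also have "\<dots> = ennreal G * (\<integral>\<^sup>+x. ennreal (exp (- Q x)) \<partial>Rn n)"
    by (rule nn_integral_cmult) measurable
  also have "\<dots> = ennreal G * ennreal (\<Prod>i<n. sqrt (pi * d i / s))"
    unfolding Q_def using Y by (subst nn_integral_tri_gaussian[OF s]) auto
  also have "\<dots> = ennreal (G * (\<Prod>i<n. sqrt (pi * d i / s)))"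
    using G0 by (simp add: ennreal_mult')
  finally show ?thesis
    using G0 s Y by (subst (asm) ennreal_le_iff) (auto intro!: mult_nonneg_nonneg prod_nonneg simp: less_imp_le)
qed

end

section \<open>The choice of the number of copies and the final estimate\<close>

lemma ex_power_of_two_between:
  fixes t :: real
  assumes "1 \<le> t"
  shows "\<exists>k::nat. t \<le> 2 ^ k \<and> 2 ^ k \<le> 2 * t"
proof -
  obtain k0 :: nat where "t < 2 ^ k0" using real_arch_pow[of 2 t] by auto
  then have ex: "\<exists>k::nat. t \<le> 2 ^ k" by (auto intro: less_imp_le)
  define k where "k = (LEAST k::nat. t \<le> 2 ^ k)"
  have k: "t \<le> 2 ^ k" unfolding k_def by (rule LeastI_ex[OF ex])
  have "2 ^ k \<le> 2 * t"
  proof (cases k)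
    case (Suc j)
    then have "\<not> t \<le> 2 ^ j" using not_less_Least[of j "\<lambda>k. t \<le> 2 ^ k"] by (simp add: k_def)
    then show ?thesis using Suc by simp
  qed (use assms in simp)
  with k show ?thesis by blast
qed

context logconcave_prob
begin

lemma depth_bound:
  assumes n: "0 < n"
  shows "(\<integral>x. tukey_depth n \<mu> x \<partial>\<mu>) \<le> exp (- (1 / (32 * exp 4 * pi)) * real n / (iso_const n \<mu> f)\<^sup>2)"
proof -
  define M where "M = Sup (f ` space (Rn n))"
  have fM: "f x \<le> M" if "x \<in> space (Rn n)" for x
    unfolding M_def using density_bounded that by (intro cSup_upper) auto
  have M: "0 < M" using ex_density_pos fM by (meson order_less_le_trans)
  obtain A b d where Y: "\<And>i. i < n \<Longrightarrow> 0 < d i \<and> integrable \<mu> (\<lambda>x. (tri A b i x)\<^sup>2) \<and> (\<integral>x. tri A b i x \<partial>\<mu>) = 0 \<and>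
      (\<integral>x. (tri A b i x)\<^sup>2 \<partial>\<mu>) = d i" and det: "det (cov_matrix n \<mu>) = (\<Prod>i<n. d i)"
    using ex_gram_schmidt by blast
  define L where "L = iso_const n \<mu> f"
  have D: "0 < (\<Prod>i<n. d i)" using Y by (intro prod_pos) auto
  have L0: "0 \<le> L" unfolding L_def iso_const_def by simp
  have Ln: "L ^ n = M * sqrt (\<Prod>i<n. d i)"
  proof -
    have pw: "(t powr a) ^ n = t powr (a * real n)" if "0 < t" for t a :: real
      using powr_realpow[of "t powr a" n] that by (simp add: powr_powr)
    have "L ^ n = (M powr (1 / real n)) ^ n * ((\<Prod>i<n. d i) powr (1 / (2 * real n))) ^ n"
      unfolding L_def iso_const_def det M_def[symmetric] by (simp add: power_mult_distrib)
    also have "(M powr (1 / real n)) ^ n = M" unfolding pw[OF M] using M n by simp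
    also have "((\<Prod>i<n. d i) powr (1 / (2 * real n))) ^ n = (\<Prod>i<n. d i) powr (1/2)"
      unfolding pw[OF D] using n by simp
    finally show ?thesis using D by (simp add: powr_half_sqrt)
  qed
  have gauss: "(\<Prod>i<n. sqrt (pi * d i / s)) = sqrt (pi / s) ^ n * sqrt (\<Prod>i<n. d i)" for s
  proof -
    have "(\<Prod>i<n. sqrt (pi * d i / s)) = (\<Prod>i<n. sqrt (pi / s) * sqrt (d i))"
      by (intro prod.cong) (auto simp: real_sqrt_mult[symmetric])
    also have "\<dots> = sqrt (pi / s) ^ n * (\<Prod>i<n. sqrt (d i))" by (simp add: prod.distrib)
    also have "(\<Prod>i<n. sqrt (d i)) = sqrt (\<Prod>i<n. d i)"
    proof -
      have "((\<Prod>i<n. sqrt (d i)))\<^sup>2 = (\<Prod>i<n. (sqrt (d i))\<^sup>2)" by (rule prod_power_distrib)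
      also have "\<dots> = (\<Prod>i<n. d i)" using Y by (intro prod.cong) (auto simp: less_imp_le)
      finally show ?thesis
        using Y by (intro real_sqrt_unique[symmetric]) (auto intro!: prod_nonneg simp: less_imp_le)
    qed
    finally show ?thesis .
  qed
  \<comment> \<open>Without averaging, the Gaussian comparison gives an absolute lower bound on
    \<open>L\<close>. It ensures \<open>1 \<le> K\<close>, so that a power of two of the right size
    exists.\<close>
  have "exp (- real n) \<le> M * (\<Prod>i<n. sqrt (pi * d i / 1))"
    by (rule density_bound_lower) (use fM Y in auto)
  then have "exp (- 1) ^ n \<le> (sqrt pi * L) ^ n"
    unfolding gauss by (simp add: power_mult_distrib Ln exp_of_nat_mult[symmetric] mult_ac)
  then have low: "exp (- 1) \<le> sqrt pi * L"
    using L0 n by (subst (asm) power_mono_iff) auto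
  \<comment> \<open>Chosen so that \<open>s \<ge> K\<^sup>2\<close> forces
    \<open>4 * exp 1 * sqrt (pi / s) * L \<le> exp (- 1)\<close>.\<close>
  define K where "K = 4 * exp 2 * sqrt pi * L"
  have "1 \<le> 4 * (exp 2 * exp (- 1 :: real))"
    using one_le_exp_iff[of "1::real"] by (simp add: exp_add[symmetric] del: one_le_exp_iff)
  also have "\<dots> \<le> 4 * (exp 2 * (sqrt pi * L))" using low by (intro mult_left_mono) auto
  finally have K1: "1 \<le> K" by (simp add: K_def mult_ac)
  then have "1 \<le> K\<^sup>2" by (simp add: power2_eq_square mult_ge1_I)
  then obtain k :: nat where k: "K\<^sup>2 \<le> 2 ^ k" "2 ^ k \<le> 2 * K\<^sup>2" using ex_power_of_two_between by blast
  define s :: real where "s = 2 ^ k"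
  have s: "0 < s" by (simp add: s_def)
  obtain \<nu> g where \<nu>: "logconcave_prob \<nu> n g"
    and H: "\<And>H. H \<in> halfspaces n \<Longrightarrow> measure \<mu> H ^ (2 ^ k) \<le> measure \<nu> H"
    and Y\<nu>: "\<And>Y. mid_affine n Y \<Longrightarrow> integrable \<mu> (\<lambda>x. (Y x)\<^sup>2) \<Longrightarrow> (\<integral>x. Y x \<partial>\<mu>) = 0 \<Longrightarrow>
      integrable \<nu> (\<lambda>x. (Y x)\<^sup>2) \<and> (\<integral>x. Y x \<partial>\<nu>) = 0 \<and> (\<integral>x. (Y x)\<^sup>2 \<partial>\<nu>) = (\<integral>x. (Y x)\<^sup>2 \<partial>\<mu>) / 2 ^ k"
    using ex_iterated_avg[OF logconcave_prob_axioms, of k] by blast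
  interpret N: logconcave_prob \<nu> n g by fact
  \<comment> \<open>Using \<open>4 ^ n / N.J\<^sup>2\<close> as the bound on \<open>g\<close> turns
    the lower bound for the size of a density into an upper bound for \<open>N.J\<close>.\<close>
  have "exp (- real n) \<le> 4 ^ n / N.J\<^sup>2 * (\<Prod>i<n. sqrt (pi * d i / s))"
  proof (rule N.density_bound_lower[OF s N.density_le])
    fix i assume i: "i < n"
    show "0 < d i \<and> integrable \<nu> (\<lambda>x. (tri A b i x)\<^sup>2) \<and> (\<integral>x. (tri A b i x)\<^sup>2 \<partial>\<nu>) = d i / s"
      using Y\<nu>[OF mid_affine_tri[OF i], of A b] Y[OF i] by (simp add: s_def)
  qed
  then have "exp (- real n) * N.J\<^sup>2 \<le> 4 ^ n * (\<Prod>i<n. sqrt (pi * d i / s))"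
    using N.J_pos by (simp add: field_simps)
  then have "exp (real n) * (exp (- real n) * N.J\<^sup>2) \<le> exp (real n) * (4 ^ n * (\<Prod>i<n. sqrt (pi * d i / s)))"
    by (intro mult_left_mono) auto
  then have J: "N.J\<^sup>2 \<le> exp (real n) * (4 ^ n * (\<Prod>i<n. sqrt (pi * d i / s)))"
    by (simp add: mult.assoc[symmetric] exp_add[symmetric])
  have "(\<integral>x. tukey_depth n \<mu> x \<partial>\<mu>) ^ (2 ^ k) \<le> M * N.J\<^sup>2"
    by (rule expectation_depth_power_le[OF \<nu> H n fM])
  also have "\<dots> \<le> M * (exp (real n) * (4 ^ n * (\<Prod>i<n. sqrt (pi * d i / s))))"
    using J M by (intro mult_left_mono) auto
  also have "\<dots> = (4 * exp 1 * sqrt (pi / s) * L) ^ n"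
    unfolding gauss by (simp add: power_mult_distrib Ln exp_of_nat_mult[symmetric] mult_ac)
  also have "\<dots> \<le> exp (- 1) ^ n"
  proof (rule power_mono)
    have "K \<le> sqrt s" using k(1) K1 by (intro real_le_rsqrt) (simp add: s_def)
    then have "K / sqrt s \<le> 1" using s by simp
    then have "exp (- 1) * (K / sqrt s) \<le> exp (- 1) * 1" by (intro mult_left_mono) auto
    moreover have "exp (- 1) * (K / sqrt s) = 4 * (exp (- 1) * exp 2) * sqrt (pi / s) * L"
      by (simp add: K_def real_sqrt_divide)
    moreover have "exp (- 1) * exp 2 = (exp 1 :: real)" by (simp add: exp_add[symmetric])
    ultimately show "4 * exp 1 * sqrt (pi / s) * L \<le> exp (- 1)" by simp
    show "0 \<le> 4 * exp 1 * sqrt (pi / s) * L" using L0 s by simp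
  qed
  \<comment> \<open>Since \<open>s = 2 ^ k\<close>, this is the same power as on the left, and the
    root can be taken.\<close>
  also have "\<dots> = exp (- real n / s) ^ (2 ^ k)"
    using s by (simp add: exp_of_nat_mult[symmetric] s_def)
  finally have "(\<integral>x. tukey_depth n \<mu> x \<partial>\<mu>) ^ (2 ^ k) \<le> exp (- real n / s) ^ (2 ^ k)" .
  then have "(\<integral>x. tukey_depth n \<mu> x \<partial>\<mu>) \<le> exp (- real n / s)"
    by (rule power_le_imp_le_base[of _ "2 ^ k - 1", simplified]) simp
  also have "\<dots> \<le> exp (- real n / (2 * K\<^sup>2))"
    using k(2) s n by (simp add: s_def frac_le)
  also have "2 * K\<^sup>2 = 32 * exp 4 * pi * L\<^sup>2"
  proof -
    have "(exp 2)\<^sup>2 = (exp 4 :: real)" by (simp add: power2_eq_square exp_add[symmetric])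
    then show ?thesis by (simp add: K_def power_mult_distrib)
  qed
  finally show ?thesis by (simp add: L_def)
qed

end

theorem theorem1p1:
  shows "\<exists>c::real. c > 0 \<and> (\<exists>n0::nat. \<forall>n \<ge> n0. \<forall>\<mu> f.
           logconcave_measure n \<mu> \<and> logconcave_density n \<mu> f \<longrightarrow>
           integral\<^sup>L \<mu> (tukey_depth n \<mu>) \<le> exp (- c * real n / (iso_const n \<mu> f)\<^sup>2))"
proof (intro exI[of _ "1 / (32 * exp 4 * pi)"] conjI exI[of _ "1::nat"] allI impI)
  \<comment> \<open>The threshold is 1 because \<open>halfspaces 0\<close> is empty; every positive
    dimension is covered.\<close>
  fix n \<mu> f assume n: "1 \<le> n" and "logconcave_measure n \<mu> \<and> logconcave_density n \<mu> f"
  then have "prob_space \<mu>" "logconcave_density n \<mu> f" by (auto simp: logconcave_measure_def)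
  then interpret logconcave_prob \<mu> n f by (simp add: logconcave_prob_def logconcave_prob_axioms_def)
  show "integral\<^sup>L \<mu> (tukey_depth n \<mu>) \<le> exp (- (1 / (32 * exp 4 * pi)) * real n / (iso_const n \<mu> f)\<^sup>2)"
    using depth_bound n by simp
qed simp

end
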